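(* Let $A$ be a self-adjoint (respectively, unitary) complex $n\times n$ matrix. Let $\mathcal{B}$ be a finite multiset of elements of $\mathbb{R}$ (respectively, of the unit circle $C^1=\{z\in\mathbb{C}:|z|=1\}$) with $|\mathcal{B}|=n$. Then there exists a self-adjoint (respectively, unitary) matrix $B\in\mathbb{C}^{n\times n}$ such that $\operatorname{sp}(B)=\mathcal{B}$ and $\operatorname{rank}(A-B)=\operatorname{dc}(\operatorname{sp}(A),\mathcal{B})$.
   Context: $\operatorname{sp}(A)$ denotes the spectrum of $A$ as a multiset of complex numbers (eigenvalues counted with multiplicity). For a finite multiset $\mathcal{A}$ of complex numbers and a set $S\subseteq\mathbb{C}$, $\mathcal{A}\cap S$ is the multiset of those elements of $\mathcal{A}$ lying in $S$, with their multiplicities in $\mathcal{A}$, and $|\cdot|$ denotes cardinality counted with multiplicity. For finite multisets $\mathcal{A},\mathcal{B}$ of complex numbers, $\operatorname{dc}(\mathcal{A},\mathcal{B})=\max_{S}\bigl||\mathcal{A}\cap S|-|\mathcal{B}\cap S|\bigr|$, where $S$ ranges over all closed discs $\{x\in\mathbb{C}:|x-a|\le r\}$ with $a\in\mathbb{C}$, $r\in\mathbb{R}^+$. *)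

theory Defs
  imports
    "Jordan_Normal_Form.Char_Poly"
    "Jordan_Normal_Form.Schur_Decomposition"
    "Jordan_Normal_Form.DL_Rank"
    "HOL-Computational_Algebra.Fundamental_Theorem_Algebra"
begin

definition self_adjoint_mat :: "complex mat \<Rightarrow> bool" where
  "self_adjoint_mat A \<longleftrightarrow> square_mat A \<and> mat_adjoint A = A"

definition unitary_mat :: "complex mat \<Rightarrow> bool" where
  "unitary_mat A \<longleftrightarrow> square_mat A \<and>
     A * mat_adjoint A = 1\<^sub>m (dim_row A) \<and> mat_adjoint A * A = 1\<^sub>m (dim_row A)"

text \<open>Eigenvalues are counted with algebraic multiplicity.\<close>

definition sp :: "complex mat \<Rightarrow> complex multiset" where
  "sp A = proots (char_poly A)"

definition closed_disc :: "complex \<Rightarrow> real \<Rightarrow> complex set" where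
  "closed_disc a r = {x. cmod (x - a) \<le> r}"

definition count_in :: "complex multiset \<Rightarrow> complex set \<Rightarrow> nat" where
  "count_in M S = size (filter_mset (\<lambda>x. x \<in> S) M)"

definition disc_diffs :: "complex multiset \<Rightarrow> complex multiset \<Rightarrow> nat set" where
  "disc_diffs M N =
     {nat \<bar>int (count_in M (closed_disc a r)) - int (count_in N (closed_disc a r))\<bar> | a r. r > 0}"

definition dc :: "complex multiset \<Rightarrow> complex multiset \<Rightarrow> nat" where
  "dc M N = Max (disc_diffs M N)"

text \<open>The maximum is taken over a finite nonempty set, so \<open>Max\<close> is meaningful.\<close>

lemma finite_disc_diffs: "finite (disc_diffs M N)"
proof (rule finite_subset)
  show "disc_diffs M N \<subseteq> {..size M + size N}"
  proof
    fix k assume "k \<in> disc_diffs M N"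
    then obtain a r where k: "k = nat \<bar>int (count_in M (closed_disc a r)) -
        int (count_in N (closed_disc a r))\<bar>"
      unfolding disc_diffs_def by blast
    have "count_in M (closed_disc a r) \<le> size M" "count_in N (closed_disc a r) \<le> size N"
      unfolding count_in_def by (rule size_filter_mset_lesseq)+
    with k show "k \<in> {..size M + size N}" by simp
  qed
qed simp

lemma disc_diffs_nonempty: "disc_diffs M N \<noteq> {}"
proof -
  have "nat \<bar>int (count_in M (closed_disc 0 1)) - int (count_in N (closed_disc 0 1))\<bar>
      \<in> disc_diffs M N"
    unfolding disc_diffs_def by (intro CollectI exI[of _ 0] exI[of _ 1] conjI refl) simp
  then show ?thesis by auto
qed

end

theory Submission
  imports Defs
begin

text \<open>Lower bound, for normal \<open>A\<close> and \<open>B\<close>: if a disc contained more than \<open>rank (A - B)\<close> more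
  eigenvalues of \<open>A\<close> than of \<open>B\<close>, a nonzero vector \<open>x\<close> with \<open>A x = B x\<close> would lie in the spectral
  subspace of \<open>A\<close> for the disc and in that of \<open>B\<close> for its complement.

  Construction in the self-adjoint case: let \<open>F t\<close> be the number of elements of \<open>sp A\<close> up to \<open>t\<close>
  minus that of the prescribed multiset. On the line discs are intervals, so
  \<open>max F - min F \<le> dc\<close>. Truncating \<open>F\<close> lowers its maximum by one and yields a multiset that
  interlaces \<open>sp A\<close>. Interlacing multisets are the spectra of \<open>D\<close> and \<open>D + v v\<^sup>T\<close> for a real diagonal
  matrix \<open>D\<close>, where the squares of the entries of \<open>v\<close> are residues of a quotient of characteristic
  polynomials. Hence \<open>max F - min F\<close> perturbations of rank one suffice.

  The unitary case reduces to this one by a Cayley transform with pole outside both spectra, which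
  preserves the rank of differences and turns intervals into arcs cut out by discs.\<close>

subsection \<open>Diagonal matrices and unitary conjugation\<close>

text \<open>A rank-one step controls spectra only: its matrix \<open>D\<close> is diagonal rather
  than the given \<open>A\<close>, and successive steps produce unrelated matrices. The spectral
  theorem removes this obstacle. Self-adjoint matrices with equal spectra are unitarily conjugate,
  and conjugating both matrices leaves the rank of their difference unchanged, so steps can be
  chained and the result moved to \<open>A\<close>. Residues enter because the characteristic
  polynomial of \<open>D + v v\<^sup>T\<close> is that of \<open>D\<close> times one minus the sum
  of the \<open>(v i)\<^sup>2 / (x - d i)\<close>. Prescribing its zeros determines the squares of
  the entries of \<open>v\<close>; interlacing makes these squares positive, so that
  \<open>v\<close> is real and the perturbed matrix self-adjoint. On the circle no function of a
  matrix is ever formed: the Cayley transform acts on eigenvalues alone, and ranks are compared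
  entrywise between two eigenbases. The construction needs only an upper bound on the rank; equality
  with \<open>dc\<close> then comes from the lower bound.\<close>

lemma index_mult_mat_sum:
  fixes A B :: "'a::semiring_0 mat"
  assumes "A \<in> carrier_mat n m" "B \<in> carrier_mat m k" "i < n" "j < k"
  shows "(A * B) $$ (i,j) = (\<Sum>l<m. A $$ (i,l) * B $$ (l,j))"
  using assms by (simp add: scalar_prod_def atLeast0LessThan)

lemma mat_adjoint_carrier [simp]:
  "A \<in> carrier_mat n m \<Longrightarrow> mat_adjoint A \<in> carrier_mat m n"
  by (auto simp: mat_adjoint_def mat_of_rows_def)

lemma index_mat_adjoint [simp]:
  fixes A :: "complex mat"
  assumes "A \<in> carrier_mat n m" "i < m" "j < n"
  shows "mat_adjoint A $$ (i,j) = cnj (A $$ (j,i))"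
  using assms by (auto simp: mat_adjoint_def mat_of_rows_def)

lemma mat_adjoint_adjoint [simp]:
  fixes A :: "complex mat"
  assumes "A \<in> carrier_mat n m"
  shows "mat_adjoint (mat_adjoint A) = A"
proof -
  have *: "mat_adjoint A \<in> carrier_mat m n" using assms by simp
  show ?thesis
    by (rule eq_matI) (use assms in \<open>auto simp: index_mat_adjoint[OF *] index_mat_adjoint[OF assms]
      carrier_matD[OF mat_adjoint_carrier[OF *]]\<close>)
qed

lemma mat_adjoint_mult:
  fixes A B :: "complex mat"
  assumes "A \<in> carrier_mat n m" "B \<in> carrier_mat m k"
  shows "mat_adjoint (A * B) = mat_adjoint B * mat_adjoint A"
proof (rule eq_matI)
  have AB: "A * B \<in> carrier_mat n k" using assms by simp
  have BA: "mat_adjoint B * mat_adjoint A \<in> carrier_mat k n" using assms by (meson mat_adjoint_carrier mult_carrier_mat)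
  show "dim_row (mat_adjoint (A * B)) = dim_row (mat_adjoint B * mat_adjoint A)"
       "dim_col (mat_adjoint (A * B)) = dim_col (mat_adjoint B * mat_adjoint A)"
    using carrier_matD[OF BA] carrier_matD[OF mat_adjoint_carrier[OF AB]] by auto
  fix i j
  assume "i < dim_row (mat_adjoint B * mat_adjoint A)" "j < dim_col (mat_adjoint B * mat_adjoint A)"
  then have ij: "i < k" "j < n" using carrier_matD[OF BA] by auto
  show "mat_adjoint (A * B) $$ (i,j) = (mat_adjoint B * mat_adjoint A) $$ (i,j)"
    unfolding index_mat_adjoint[OF AB ij] index_mult_mat_sum[OF assms ij(2,1)]
      index_mult_mat_sum[OF mat_adjoint_carrier[OF assms(2)] mat_adjoint_carrier[OF assms(1)] ij]
    using assms ij by (simp add: mult.commute cnj_sum)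
qed

lemma mat_adjoint_one [simp]: "mat_adjoint (1\<^sub>m n :: complex mat) = 1\<^sub>m n"
proof (rule eq_matI)
  note c = mat_adjoint_carrier[of "1\<^sub>m n :: complex mat" n n]
  show "dim_row (mat_adjoint (1\<^sub>m n :: complex mat)) = dim_row (1\<^sub>m n :: complex mat)"
       "dim_col (mat_adjoint (1\<^sub>m n :: complex mat)) = dim_col (1\<^sub>m n :: complex mat)"
    using carrier_matD[OF c] by auto
qed (auto simp: index_mat_adjoint[of _ n n])

definition diagonal :: "nat \<Rightarrow> (nat \<Rightarrow> complex) \<Rightarrow> complex mat" where
  "diagonal n f = mat n n (\<lambda>(i,j). if i = j then f i else 0)"

lemma diagonal_carrier [simp]: "diagonal n f \<in> carrier_mat n n"
  by (simp add: diagonal_def)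

lemma diagonal_dim [simp]: "dim_row (diagonal n f) = n" "dim_col (diagonal n f) = n"
  by (simp_all add: diagonal_def)

lemma index_diagonal [simp]:
  "i < n \<Longrightarrow> j < n \<Longrightarrow> diagonal n f $$ (i,j) = (if i = j then f i else 0)"
  by (simp add: diagonal_def)

lemma diagonal_mult_index [simp]:
  assumes "M \<in> carrier_mat n m" "i < n" "j < m"
  shows "(diagonal n f * M) $$ (i,j) = f i * M $$ (i,j)"
  using assms by (simp add: index_mult_mat_sum[OF diagonal_carrier assms] if_distrib[of "\<lambda>x. x * _"]
    sum.delta cong: if_cong)

lemma mult_diagonal_index [simp]:
  assumes "M \<in> carrier_mat m n" "i < m" "j < n"
  shows "(M * diagonal n f) $$ (i,j) = M $$ (i,j) * f j"
  using assms by (simp add: index_mult_mat_sum[OF assms(1) diagonal_carrier assms(2,3)] if_distrib[of "\<lambda>x. _ * x"]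
    sum.delta' cong: if_cong)

lemma diagonal_mult: "diagonal n f * diagonal n g = diagonal n (\<lambda>i. f i * g i)"
  by (rule eq_matI) (auto simp: diagonal_mult_index[OF diagonal_carrier] simp del: index_mult_mat(1))

lemma mat_adjoint_diagonal: "mat_adjoint (diagonal n f) = diagonal n (\<lambda>i. cnj (f i))"
proof (rule eq_matI)
  note c = mat_adjoint_carrier[OF diagonal_carrier[of n f]]
  show "dim_row (mat_adjoint (diagonal n f)) = dim_row (diagonal n (\<lambda>i. cnj (f i)))"
       "dim_col (mat_adjoint (diagonal n f)) = dim_col (diagonal n (\<lambda>i. cnj (f i)))"
    using carrier_matD[OF c] by auto
qed (auto simp: index_mat_adjoint[of _ n n])

lemma diagonal_one: "diagonal n (\<lambda>_. 1) = 1\<^sub>m n"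
  by (rule eq_matI) auto

lemma diagonal_cong: "(\<And>i. i < n \<Longrightarrow> f i = g i) \<Longrightarrow> diagonal n f = diagonal n g"
  by (rule eq_matI) auto

definition normal_mat :: "complex mat \<Rightarrow> bool" where
  "normal_mat A \<longleftrightarrow> A * mat_adjoint A = mat_adjoint A * A"

definition unitaries :: "nat \<Rightarrow> complex mat set" where
  "unitaries n = {U \<in> carrier_mat n n. unitary_mat U}"

lemma unitariesI:
  assumes "U \<in> carrier_mat n n" "mat_adjoint U * U = 1\<^sub>m n"
  shows "U \<in> unitaries n"
  using assms mat_mult_left_right_inverse[OF mat_adjoint_carrier[OF assms(1)] assms(1)]
  by (auto simp: unitaries_def unitary_mat_def)

lemma unitariesD:
  assumes "U \<in> unitaries n"
  shows "U \<in> carrier_mat n n" "mat_adjoint U \<in> carrier_mat n n"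
    "U * mat_adjoint U = 1\<^sub>m n" "mat_adjoint U * U = 1\<^sub>m n"
  using assms by (auto simp: unitaries_def unitary_mat_def)

lemma mat_adjoint_unitaries: "U \<in> unitaries n \<Longrightarrow> mat_adjoint U \<in> unitaries n"
  by (rule unitariesI) (simp_all add: unitariesD mat_adjoint_adjoint[of _ n n])

lemma mult_sandwich:
  fixes U :: "'a::semiring_1 mat"
  assumes "A \<in> carrier_mat n n" "U \<in> carrier_mat n n" "V \<in> carrier_mat n n" "B \<in> carrier_mat n n"
    "U * V = 1\<^sub>m n"
  shows "A * U * (V * B) = A * B"
proof -
  have "A * U * (V * B) = A * (U * (V * B))"
    using assms by (intro assoc_mult_mat[of _ n n _ n _ n]) (auto intro: mult_carrier_mat)
  also have "U * (V * B) = U * V * B"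
    using assms by (intro assoc_mult_mat[of _ n n _ n _ n, symmetric])
  finally show ?thesis using assms by simp
qed

lemma mult_unitaries:
  assumes U: "U \<in> unitaries n" and V: "V \<in> unitaries n"
  shows "U * V \<in> unitaries n"
proof (rule unitariesI)
  note [simp] = unitariesD[OF U] unitariesD[OF V]
  show "U * V \<in> carrier_mat n n" by (simp add: mult_carrier_mat[of _ n n])
  show "mat_adjoint (U * V) * (U * V) = 1\<^sub>m n"
    by (simp add: mat_adjoint_mult[of _ n n _ n] mult_sandwich[of _ n])
qed

definition conj_by :: "complex mat \<Rightarrow> complex mat \<Rightarrow> complex mat" where
  "conj_by U A = U * A * mat_adjoint U"

lemma conj_by_carrier [simp]:
  "U \<in> carrier_mat n n \<Longrightarrow> A \<in> carrier_mat n n \<Longrightarrow> conj_by U A \<in> carrier_mat n n"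
  by (simp add: conj_by_def mult_carrier_mat[of _ n n])

lemma conj_by_conj_by:
  assumes "U \<in> carrier_mat n n" "V \<in> carrier_mat n n" "A \<in> carrier_mat n n"
  shows "conj_by U (conj_by V A) = conj_by (U * V) A"
  using assms by (simp add: conj_by_def mat_adjoint_mult[of _ n n _ n]
    assoc_mult_mat[of _ n n _ n _ n] mult_carrier_mat[of _ n n])

lemma conj_by_one [simp]: "A \<in> carrier_mat n n \<Longrightarrow> conj_by (1\<^sub>m n) A = A"
  by (simp add: conj_by_def)

lemma conj_by_inverse:
  assumes "U \<in> unitaries n" "A \<in> carrier_mat n n"
  shows "conj_by (mat_adjoint U) (conj_by U A) = A" "conj_by U (conj_by (mat_adjoint U) A) = A"
  using unitariesD[OF assms(1)] assms(2) by (simp_all add: conj_by_conj_by[of _ n])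

lemma conj_by_mult:
  assumes U: "U \<in> unitaries n" and AB: "A \<in> carrier_mat n n" "B \<in> carrier_mat n n"
  shows "conj_by U A * conj_by U B = conj_by U (A * B)"
proof -
  note [simp] = unitariesD[OF U] AB mult_carrier_mat[of _ n n]
  have "conj_by U A * conj_by U B = U * A * mat_adjoint U * (U * (B * mat_adjoint U))"
    by (simp add: conj_by_def assoc_mult_mat[of _ n n _ n _ n])
  also have "\<dots> = U * A * (B * mat_adjoint U)"
    by (rule mult_sandwich) simp_all
  finally show ?thesis by (simp add: conj_by_def assoc_mult_mat[of _ n n _ n _ n])
qed

lemma mat_adjoint_conj_by:
  assumes "U \<in> carrier_mat n n" "A \<in> carrier_mat n n"
  shows "mat_adjoint (conj_by U A) = conj_by U (mat_adjoint A)"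
  using assms by (simp add: conj_by_def mat_adjoint_mult[of _ n n _ n]
    assoc_mult_mat[of _ n n _ n _ n] mult_carrier_mat[of _ n n])

lemma conj_by_minus:
  assumes "U \<in> carrier_mat n n" "A \<in> carrier_mat n n" "B \<in> carrier_mat n n"
  shows "conj_by U (A - B) = conj_by U A - conj_by U B"
  using assms by (simp add: conj_by_def mult_minus_distrib_mat[of _ n n _ n]
    minus_mult_distrib_mat[of _ n n _ _ n] mult_carrier_mat[of _ n n])

lemma normal_conj_by:
  assumes U: "U \<in> unitaries n" and A: "A \<in> carrier_mat n n" "normal_mat A"
  shows "normal_mat (conj_by U A)"
  using assms unitariesD[OF U]
  by (simp add: normal_mat_def mat_adjoint_conj_by[of _ n] conj_by_mult[of _ n])

lemma char_poly_conj_by: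
  assumes U: "U \<in> unitaries n" and A: "A \<in> carrier_mat n n"
  shows "char_poly (conj_by U A) = char_poly A"
proof (rule char_poly_similar, unfold similar_mat_def, intro exI)
  show "similar_mat_wit (conj_by U A) A U (mat_adjoint U)"
    by (rule similar_mat_witI[of _ _ n]) (use unitariesD[OF U] A in \<open>auto simp: conj_by_def mult_carrier_mat[of _ n n]\<close>)
qed

lemma char_poly_diagonal: "char_poly (diagonal n f) = (\<Prod>i<n. [:- f i, 1:])"
proof -
  have "upper_triangular (diagonal n f)" by (auto simp: upper_triangular_def)
  from char_poly_upper_triangular[OF diagonal_carrier this] show ?thesis
    by (simp add: diag_mat_def prod.list_conv_set_nth atLeast0LessThan)
qed

text \<open>The characteristic polynomial is monic and splits over the complex numbers, so it and
  its multiset of roots determine each other.\<close>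

lemma sp_eq_iff:
  fixes A :: "complex mat"
  assumes A: "A \<in> carrier_mat n n"
  shows "sp A = M \<longleftrightarrow> char_poly A = (\<Prod>x\<in>#M. [:- x, 1:])"
proof
  assume "sp A = M"
  then show "char_poly A = (\<Prod>x\<in>#M. [:- x, 1:])"
    using complex_poly_decompose_multiset[of "char_poly A"] degree_monic_char_poly[OF A]
    by (auto simp: sp_def)
next
  assume "char_poly A = (\<Prod>x\<in>#M. [:- x, 1:])"
  then show "sp A = M"
    using proots_prod_mset[of "{#[:- x, 1:]. x \<in># M#}"]
    by (auto simp: sp_def image_mset.compositionality o_def pCons_eq_0_iff image_iff)
qed

lemma size_sp: 
  assumes "A \<in> carrier_mat n n" 
  shows "size (sp A) = n"
  using degree_monic_char_poly[OF assms] by (simp add: sp_def size_proots_complex)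

lemma sp_conj_by_diagonal:
  assumes "U \<in> unitaries n" "length xs = n"
  shows "sp (conj_by U (diagonal n (\<lambda>i. xs ! i))) = mset xs"
proof -
  have "(\<Prod>i<length xs. [:- (xs ! i), 1:]) = (\<Prod>x\<leftarrow>xs. [:- x, 1:])"
    by (simp add: prod.list_conv_set_nth atLeast0LessThan)
  then show ?thesis
    using assms unitariesD[OF assms(1)]
    by (subst sp_eq_iff[of _ n]) (simp_all add: char_poly_conj_by[of _ n] char_poly_diagonal prod_mset_prod_list flip: mset_map)
qed

lemma conj_by_diagonal_self_adjoint:
  assumes "U \<in> unitaries n" "\<And>i. i < n \<Longrightarrow> f i \<in> \<real>"
  shows "self_adjoint_mat (conj_by U (diagonal n f))"
proof -
  have c: "conj_by U (diagonal n f) \<in> carrier_mat n n" using unitariesD[OF assms(1)] by simp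
  have "diagonal n (\<lambda>i. cnj (f i)) = diagonal n f"
    using assms(2) by (intro diagonal_cong) (simp add: Reals_cnj_iff)
  then show ?thesis using unitariesD[OF assms(1)] carrier_matD[OF c]
    by (auto simp: self_adjoint_mat_def mat_adjoint_conj_by[of _ n] mat_adjoint_diagonal)
qed

lemma conj_by_diagonal_unitary:
  assumes "U \<in> unitaries n" "\<And>i. i < n \<Longrightarrow> cmod (f i) = 1"
  shows "unitary_mat (conj_by U (diagonal n f))"
proof -
  note [simp] = unitariesD[OF assms(1)]
  have "mat_adjoint (conj_by U (diagonal n f)) * conj_by U (diagonal n f) = conj_by U (diagonal n (\<lambda>i. cnj (f i) * f i))"
    using assms(1) by (simp add: mat_adjoint_conj_by[of _ n] mat_adjoint_diagonal conj_by_mult[of _ n] diagonal_mult)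
  also have "diagonal n (\<lambda>i. cnj (f i) * f i) = diagonal n (\<lambda>_. 1)"
    using assms(2) by (intro diagonal_cong) (simp add: complex_norm_square[symmetric] mult.commute[of "cnj _"])
  also have "conj_by U \<dots> = 1\<^sub>m n" by (simp add: diagonal_one conj_by_def right_mult_one_mat[of _ n n])
  finally show ?thesis
    using unitariesI[of "conj_by U (diagonal n f)" n] by (simp add: unitaries_def)
qed

subsection \<open>The spectral theorem for normal matrices\<close>

text \<open>Gram-Schmidt applied to a basis that begins with \<open>v\<close> keeps \<open>v\<close>
  in front. It orthogonalises without normalising, so the columns are divided by their norms;
  \<open>c\<close> is the reciprocal of the norm of \<open>v\<close>.\<close>

lemma unitary_completion:
  fixes v :: "complex vec"
  assumes v: "v \<in> carrier_vec n" "v \<noteq> 0\<^sub>v n"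
  obtains U c where "U \<in> unitaries n" "c \<noteq> 0" "\<And>i. i < n \<Longrightarrow> U $$ (i,0) = c * v $ i"
proof -
  interpret cof_vec_space n "TYPE(complex)" .
  define b where "b = basis_completion v"
  define ws where "ws = gram_schmidt n b"
  note bc = basis_completion[OF v, folded b_def]
  from gram_schmidt_result[OF bc(2,4) _ ws_def] bc
  have ws: "set ws \<subseteq> carrier_vec n" "corthogonal ws" "length ws = n" by auto
  have n: "n > 0" using v by (cases n) auto
  have hd: "hd ws = v"
    using bc(6,7) n gram_schmidt_hd[OF v(1), of "tl b"] by (cases b) (auto simp: ws_def)
  then have ws0: "ws ! 0 = v" using ws(3) n by (cases ws) auto
  have wsc: "ws ! i \<in> carrier_vec n" if "i < n" for i using ws that by auto
  define N where "N i = (\<Sum>l<n. (cmod (ws ! i $ l))\<^sup>2)" for i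
  have ip: "ws ! j \<bullet>c ws ! i = (\<Sum>l<n. cnj (ws ! i $ l) * ws ! j $ l)" if "i < n" "j < n" for i j
    using wsc[OF that(1)] wsc[OF that(2)] by (simp add: scalar_prod_def atLeast0LessThan mult.commute)
  have Nip: "ws ! i \<bullet>c ws ! i = of_real (N i)" if "i < n" for i
    unfolding ip[OF that that] N_def by (simp add: complex_norm_square mult.commute del: of_real_power)
  have N: "N i > 0" if "i < n" for i
  proof -
    have "ws ! i \<bullet>c ws ! i \<noteq> 0" using ws(2,3) that by (auto simp: corthogonal_def)
    then have "N i \<noteq> 0" using Nip[OF that] by auto
    moreover have "N i \<ge> 0" by (simp add: N_def sum_nonneg)
    ultimately show ?thesis by simp
  qed
  define U where "U = mat n n (\<lambda>(i,j). ws ! j $ i / of_real (sqrt (N j)))"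
  have U: "U \<in> carrier_mat n n" by (simp add: U_def)
  have "mat_adjoint U * U = 1\<^sub>m n"
  proof (rule eq_matI)
    fix i j assume "i < dim_row (1\<^sub>m n :: complex mat)" "j < dim_col (1\<^sub>m n :: complex mat)"
    then have ij: "i < n" "j < n" by auto
    have "(mat_adjoint U * U) $$ (i,j) = (\<Sum>l<n. cnj (U $$ (l,i)) * U $$ (l,j))"
      using ij U by (simp add: index_mult_mat_sum[OF mat_adjoint_carrier[OF U] U] index_mat_adjoint[OF U])
    also have "\<dots> = (ws ! j \<bullet>c ws ! i) / (of_real (sqrt (N i)) * of_real (sqrt (N j)))"
      unfolding ip[OF ij] sum_divide_distrib using ij by (intro sum.cong) (auto simp: U_def)
    also have "\<dots> = (if i = j then 1 else 0)"
    proof (cases "i = j")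
      case True
      then show ?thesis using N[OF ij(2)] Nip[OF ij(2)] by (simp flip: of_real_mult)
    next
      case False
      then show ?thesis using ws(2,3) ij by (auto simp: corthogonal_def)
    qed
    finally show "(mat_adjoint U * U) $$ (i,j) = 1\<^sub>m n $$ (i,j)" using ij by simp
  qed (use U carrier_matD[OF mat_adjoint_carrier[OF U]] in auto)
  then have "U \<in> unitaries n" using U by (intro unitariesI)
  moreover have "1 / of_real (sqrt (N 0)) \<noteq> (0 :: complex)" using N[OF n] by simp
  moreover have "U $$ (i,0) = 1 / of_real (sqrt (N 0)) * v $ i" if "i < n" for i
    using that n by (simp add: U_def ws0)
  ultimately show thesis by (rule that)
qed

text \<open>The direct sum of the scalar \<open>a\<close> and \<open>A\<close>. Splitting the
  indices into \<open>0\<close> and \<open>Suc\<close> fits the induction on the size that splits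
  off one eigenvalue at a time.\<close>

definition one_plus :: "nat \<Rightarrow> complex \<Rightarrow> complex mat \<Rightarrow> complex mat" where
  "one_plus m a A = mat (Suc m) (Suc m) (\<lambda>(i,j). case i of
     0 \<Rightarrow> (case j of 0 \<Rightarrow> a | Suc _ \<Rightarrow> 0) | Suc i' \<Rightarrow> (case j of 0 \<Rightarrow> 0 | Suc j' \<Rightarrow> A $$ (i',j')))"

lemma one_plus_carrier [simp]: "one_plus m a A \<in> carrier_mat (Suc m) (Suc m)"
  by (simp add: one_plus_def)

lemma index_one_plus [simp]:
  "one_plus m a A $$ (0,0) = a"
  "j < m \<Longrightarrow> one_plus m a A $$ (0,Suc j) = 0"
  "i < m \<Longrightarrow> one_plus m a A $$ (Suc i,0) = 0"
  "i < m \<Longrightarrow> j < m \<Longrightarrow> one_plus m a A $$ (Suc i,Suc j) = A $$ (i,j)"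
  by (simp_all add: one_plus_def)

lemma eq_mat_SucI:
  assumes "A \<in> carrier_mat (Suc m) (Suc m)" "B \<in> carrier_mat (Suc m) (Suc m)"
    "A $$ (0,0) = B $$ (0,0)"
    "\<And>j. j < m \<Longrightarrow> A $$ (0,Suc j) = B $$ (0,Suc j)"
    "\<And>i. i < m \<Longrightarrow> A $$ (Suc i,0) = B $$ (Suc i,0)"
    "\<And>i j. i < m \<Longrightarrow> j < m \<Longrightarrow> A $$ (Suc i,Suc j) = B $$ (Suc i,Suc j)"
  shows "A = B"
proof (rule eq_matI)
  fix i j assume "i < dim_row B" "j < dim_col B"
  then show "A $$ (i,j) = B $$ (i,j)"
    using assms by (cases i; cases j) auto
qed (use assms in auto)

lemma one_plus_mult:
  assumes "A \<in> carrier_mat m m" "B \<in> carrier_mat m m"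
  shows "one_plus m a A * one_plus m b B = one_plus m (a * b) (A * B)"
  by (rule eq_mat_SucI[of _ m])
     (use assms in \<open>auto simp: index_mult_mat_sum[of _ "Suc m" "Suc m" _ "Suc m"] index_mult_mat_sum[of _ m m _ m]
        sum.lessThan_Suc_shift mult_carrier_mat[of _ "Suc m" "Suc m"] simp del: index_mult_mat(1) sum.lessThan_Suc\<close>)

lemma one_plus_adjoint:
  assumes "A \<in> carrier_mat m m"
  shows "mat_adjoint (one_plus m a A) = one_plus m (cnj a) (mat_adjoint A)"
  by (rule eq_mat_SucI[of _ m])
     (use assms in \<open>auto simp: index_mat_adjoint[of _ "Suc m" "Suc m"] index_mat_adjoint[of _ m m]\<close>)

lemma one_plus_one: "one_plus m 1 (1\<^sub>m m) = 1\<^sub>m (Suc m)"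
  by (rule eq_mat_SucI) auto

lemma one_plus_diagonal: "one_plus m a (diagonal m (\<lambda>i. f (Suc i))) = diagonal (Suc m) (\<lambda>i. case i of 0 \<Rightarrow> a | Suc i \<Rightarrow> f (Suc i))"
  by (rule eq_mat_SucI) auto

lemma one_plus_inject:
  assumes "one_plus m a A = one_plus m b B" "A \<in> carrier_mat m m" "B \<in> carrier_mat m m"
  shows "A = B"
proof (rule eq_matI)
  fix i j assume "i < dim_row B" "j < dim_col B"
  then show "A $$ (i,j) = B $$ (i,j)"
    using assms(2,3) index_one_plus(4)[of i m j] assms(1) by (metis carrier_matD)
qed (use assms in auto)

lemma one_plus_unitaries:
  assumes "U \<in> unitaries m"
  shows "one_plus m 1 U \<in> unitaries (Suc m)"
  using unitariesD[OF assms] by (intro unitariesI) (simp_all add: one_plus_adjoint one_plus_mult one_plus_one)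

lemma conj_by_one_plus:
  assumes "U \<in> unitaries m" "A \<in> carrier_mat m m"
  shows "conj_by (one_plus m 1 U) (one_plus m a A) = one_plus m a (conj_by U A)"
  using unitariesD[OF assms(1)] assms(2)
  by (simp add: conj_by_def one_plus_adjoint one_plus_mult mult_carrier_mat[of _ m m])

lemma char_poly_one_plus:
  assumes "A \<in> carrier_mat m m"
  shows "char_poly (one_plus m a A) = [:- a, 1:] * char_poly A"
proof -
  have "one_plus m a A = four_block_mat (diagonal 1 (\<lambda>_. a)) (0\<^sub>m 1 m) (0\<^sub>m m 1) A"
    by (rule eq_mat_SucI) (use assms in auto)
  then show ?thesis
    using char_poly_four_block_zeros_col[of "diagonal 1 (\<lambda>_. a)" "0\<^sub>m 1 m" m A] assms
    by (simp add: char_poly_diagonal)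
qed

text \<open>Comparing the squared lengths of the first row and the first column forces the first row
  to vanish off the diagonal.\<close>

lemma normal_first_column:
  assumes A: "A \<in> carrier_mat (Suc m) (Suc m)" "normal_mat A"
    and col: "\<And>i. i < m \<Longrightarrow> A $$ (Suc i,0) = 0"
  obtains B where "B \<in> carrier_mat m m" "normal_mat B" "A = one_plus m (A $$ (0,0)) B"
proof -
  define B where "B = mat m m (\<lambda>(i,j). A $$ (Suc i,Suc j))"
  have B: "B \<in> carrier_mat m m" by (simp add: B_def)
  note adj = mat_adjoint_carrier[OF A(1)] index_mat_adjoint[OF A(1)]
  have "(A * mat_adjoint A) $$ (0,0) = (\<Sum>l<Suc m. of_real ((cmod (A $$ (0,l)))\<^sup>2))"
    using A by (simp add: index_mult_mat_sum[OF A(1) adj(1)] adj(2) complex_norm_square del: sum.lessThan_Suc of_real_power index_mult_mat(1))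
  moreover have "(mat_adjoint A * A) $$ (0,0) = (\<Sum>l<Suc m. of_real ((cmod (A $$ (l,0)))\<^sup>2))"
    using A by (simp add: index_mult_mat_sum[OF adj(1) A(1)] adj(2) complex_norm_square mult.commute del: sum.lessThan_Suc of_real_power index_mult_mat(1))
  ultimately have "(\<Sum>l<Suc m. (cmod (A $$ (0,l)))\<^sup>2) = (\<Sum>l<Suc m. (cmod (A $$ (l,0)))\<^sup>2)"
    using A(2) unfolding normal_mat_def by (metis of_real_eq_iff of_real_sum)
  then have "(\<Sum>l<m. (cmod (A $$ (0,Suc l)))\<^sup>2) = 0"
    using col by (simp add: sum.lessThan_Suc_shift del: sum.lessThan_Suc)
  then have row: "A $$ (0,Suc j) = 0" if "j < m" for j
    using that by (subst (asm) sum_nonneg_eq_0_iff) auto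
  have eq: "A = one_plus m (A $$ (0,0)) B"
    by (rule eq_mat_SucI) (use A row col in \<open>auto simp: B_def\<close>)
  have "one_plus m (A $$ (0,0) * cnj (A $$ (0,0))) (B * mat_adjoint B) = A * mat_adjoint A"
    by (subst (3 4) eq) (simp add: one_plus_adjoint one_plus_mult B)
  also have "\<dots> = mat_adjoint A * A" using A(2) by (simp add: normal_mat_def)
  also have "\<dots> = one_plus m (cnj (A $$ (0,0)) * A $$ (0,0)) (mat_adjoint B * B)"
    by (subst (1 2) eq) (simp add: one_plus_adjoint one_plus_mult B)
  finally have "normal_mat B"
    unfolding normal_mat_def by (rule one_plus_inject) (use B in \<open>auto simp: mult_carrier_mat[of _ m m]\<close>)
  then show thesis using that B eq by blast
qed

text \<open>Deflation: conjugating by a unitary matrix whose first column is an eigenvector for the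
  head of \<open>es\<close> splits off that eigenvalue, and normality passes to the remaining
  block.\<close>

lemma normal_diagonalization_list:
  assumes "A \<in> carrier_mat n n" "normal_mat A" "char_poly A = (\<Prod>e\<leftarrow>es. [:- e, 1:])"
  shows "\<exists>U \<in> unitaries n. A = conj_by U (diagonal n (\<lambda>i. es ! i))"
  using assms
proof (induction es arbitrary: n A)
  case Nil
  then have "n = 0" using degree_monic_char_poly[OF Nil(1)] by simp
  have "1\<^sub>m n \<in> unitaries n" by (rule unitariesI) auto
  moreover have "A = conj_by (1\<^sub>m n) (diagonal n (\<lambda>i. [] ! i))"
    using Nil(1) \<open>n = 0\<close> by (intro eq_matI) (auto simp: conj_by_def mat_adjoint_def mat_of_rows_def)
  ultimately show ?case by blast
next
  case (Cons e es)
  note A = Cons.prems(1)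
  have deg: "degree (char_poly A) = Suc (length es)"
    using Cons.prems(3) degree_linear_factors[of uminus "e # es"] by simp
  define m where "m = length es"
  have n: "n = Suc m" using deg degree_monic_char_poly[OF A] by (simp add: m_def)
  have "eigenvalue A e" unfolding eigenvalue_root_char_poly[OF A] Cons.prems(3) by simp
  then obtain v where v: "v \<in> carrier_vec n" "v \<noteq> 0\<^sub>v n" "A *\<^sub>v v = e \<cdot>\<^sub>v v"
    using A by (auto simp: eigenvalue_def eigenvector_def)
  obtain U c where U: "U \<in> unitaries n" and c: "c \<noteq> 0" "\<And>i. i < n \<Longrightarrow> U $$ (i,0) = c * v $ i"
    using unitary_completion[OF v(1,2)] by blast
  note [simp] = unitariesD[OF U]
  define A' where "A' = conj_by (mat_adjoint U) A"
  have A': "A' \<in> carrier_mat n n" using A by (simp add: A'_def)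
  have "normal_mat A'" unfolding A'_def
    by (rule normal_conj_by[OF mat_adjoint_unitaries[OF U] A Cons.prems(2)])
  have A_eq: "A = conj_by U A'" using conj_by_inverse[OF U A] by (simp add: A'_def)
  have AU: "A * U \<in> carrier_mat n n" using A by (simp add: mult_carrier_mat[of _ n n])
  have AUcol: "(A * U) $$ (l,0) = e * U $$ (l,0)" if "l < n" for l
  proof -
    have "(A * U) $$ (l,0) = (\<Sum>k<n. A $$ (l,k) * (c * v $ k))"
      using that n by (subst index_mult_mat_sum[OF A unitariesD(1)[OF U]]) (auto simp: c)
    also have "\<dots> = c * (A *\<^sub>v v) $ l"
      using that A v(1) by (simp add: scalar_prod_def atLeast0LessThan sum_distrib_left mult_ac)
    also have "\<dots> = e * U $$ (l,0)" using that v c by simp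
    finally show ?thesis .
  qed
  \<comment> \<open>\<open>A * U\<close> has \<open>e\<close> times the first column of
    \<open>U\<close> as its own first column, and multiplication by \<open>mat_adjoint U\<close>
    turns it into \<open>e\<close> times the first unit vector.\<close>
  have A'col: "A' $$ (i,0) = e * 1\<^sub>m n $$ (i,0)" if "i < n" for i
  proof -
    have "A' = mat_adjoint U * (A * U)"
      using A by (simp add: A'_def conj_by_def mat_adjoint_adjoint[of _ n n] assoc_mult_mat[of _ n n _ n _ n])
    then have "A' $$ (i,0) = (\<Sum>l<n. mat_adjoint U $$ (i,l) * (e * U $$ (l,0)))"
      using that n by (simp add: index_mult_mat_sum[OF unitariesD(2)[OF U] AU] AUcol del: index_mult_mat(1))
    also have "\<dots> = e * (mat_adjoint U * U) $$ (i,0)"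
      using that n by (subst index_mult_mat_sum[OF unitariesD(2,1)[OF U]])
        (auto simp: sum_distrib_left mult_ac simp del: sum.lessThan_Suc)
    finally show ?thesis by simp
  qed
  obtain B where B: "B \<in> carrier_mat m m" "normal_mat B" "A' = one_plus m (A' $$ (0,0)) B"
    using normal_first_column[OF A'[unfolded n] \<open>normal_mat A'\<close>] A'col n by auto
  then have A'_eq: "A' = one_plus m e B" using A'col[of 0] n by simp
  have "[:- e, 1:] * char_poly B = char_poly A'" by (simp add: A'_eq char_poly_one_plus B)
  also have "\<dots> = [:- e, 1:] * (\<Prod>e\<leftarrow>es. [:- e, 1:])"
    using Cons.prems(3) char_poly_conj_by[OF U A'] A_eq by simp
  finally have "char_poly B = (\<Prod>e\<leftarrow>es. [:- e, 1:])"
    by (metis mult_cancel_left pCons_eq_0_iff zero_neq_one)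
  from Cons.IH[OF B(1,2) this] obtain W where W: "W \<in> unitaries m" "B = conj_by W (diagonal m (\<lambda>i. es ! i))"
    by blast
  have "A' = conj_by (one_plus m 1 W) (one_plus m e (diagonal m (\<lambda>i. (e # es) ! Suc i)))"
    using W by (simp add: A'_eq conj_by_one_plus)
  also have "one_plus m e (diagonal m (\<lambda>i. (e # es) ! Suc i)) = diagonal n (\<lambda>i. (e # es) ! i)"
    unfolding n one_plus_diagonal by (rule diagonal_cong) (auto split: nat.split)
  finally have "A = conj_by (U * one_plus m 1 W) (diagonal n (\<lambda>i. (e # es) ! i))"
    using one_plus_unitaries[OF W(1)] n unitariesD(1) unitariesD(1)[OF U] by (subst A_eq) (auto intro!: conj_by_conj_by)
  moreover have "U * one_plus m 1 W \<in> unitaries n"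
    using one_plus_unitaries[OF W(1)] U n by (auto intro: mult_unitaries)
  ultimately show ?case by blast
qed

text \<open>The order of the eigenvalues is free. Two normal matrices with the same spectrum can
  therefore be given the same diagonal factor, which makes them unitarily conjugate.\<close>

theorem normal_diagonalization:
  assumes "A \<in> carrier_mat n n" "normal_mat A" "sp A = mset es"
  obtains U where "U \<in> unitaries n" "A = conj_by U (diagonal n (\<lambda>i. es ! i))"
proof -
  have "char_poly A = (\<Prod>e\<leftarrow>es. [:- e, 1:])"
    using assms by (simp add: sp_eq_iff prod_mset_prod_list flip: mset_map)
  then show thesis using normal_diagonalization_list[OF assms(1,2)] that by blast
qed

subsection \<open>Rank, and the lower bound\<close>

lemma rank_sum_outer_products:
  fixes M :: "complex mat"
  assumes "M \<in> carrier_mat n m" "\<And>i j. i < n \<Longrightarrow> j < m \<Longrightarrow> M $$ (i,j) = (\<Sum>l<r. p i l * q l j)"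
  shows "vec_space.rank n M \<le> r"
  using assms
proof (induction r arbitrary: M)
  case 0
  then have "M = 0\<^sub>m n m" by (intro eq_matI) auto
  then show ?case by (simp add: vec_space.rank_0I)
next
  case (Suc r)
  define M1 where "M1 = mat n m (\<lambda>(i,j). \<Sum>l<r. p i l * q l j)"
  define M2 where "M2 = mat n m (\<lambda>(i,j). p i r * q r j)"
  have c: "M1 \<in> carrier_mat n m" "M2 \<in> carrier_mat n m" by (simp_all add: M1_def M2_def)
  have "M = M1 + M2" using Suc.prems by (intro eq_matI) (auto simp: M1_def M2_def)
  then have "vec_space.rank n M \<le> vec_space.rank n M1 + vec_space.rank n M2"
    using vec_space.rank_subadditive[OF c] by simp
  also have "vec_space.rank n M1 \<le> r" by (rule Suc.IH) (simp_all add: M1_def)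
  also have "vec_space.rank n M2 \<le> 1"
    by (rule vec_space.rank_le_1_product_entries[OF c(2), of "\<lambda>i. p i r" "\<lambda>j. q r j"]) (simp_all add: M2_def)
  finally show ?case by simp
qed

text \<open>A maximal independent set of columns of \<open>M\<close> supplies the columns of
  \<open>P\<close>, and \<open>Q\<close> holds the coordinates of all columns in it. With such a
  factorization, \<open>M\<close> annihilates every vector satisfying \<open>rank M\<close> linear
  equations, the rows of \<open>Q\<close>.\<close>

lemma rank_factorization:
  fixes M :: "complex mat"
  assumes M: "M \<in> carrier_mat n m"
  obtains P Q where "P \<in> carrier_mat n (vec_space.rank n M)" "Q \<in> carrier_mat (vec_space.rank n M) m" "M = P * Q"
proof -
  interpret vec_space "TYPE(complex)" n .
  have cols: "set (cols M) \<subseteq> carrier_vec n" using M cols_dim by blast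
  obtain S where S: "maximal S (\<lambda>T. T \<subseteq> set (cols M) \<and> lin_indpt T)"
    using maximal_exists_superset[of "set (cols M)" "\<lambda>T. T \<subseteq> set (cols M) \<and> lin_indpt T" "{}"]
    by (metis List.finite_set empty_subsetI finite_lin_indpt2 finite.emptyI lindep_span empty_iff)
  have Sc: "S \<subseteq> set (cols M)" "lin_indpt S" using S by (auto simp: maximal_def)
  have Sv: "S \<subseteq> carrier_vec n" using Sc cols by auto
  have fin: "finite S" using Sc finite_subset by blast
  have rank: "rank M = card S" by (rule rank_card_indpt[OF M S])
  obtain ss where ss: "set ss = S" "distinct ss" using finite_distinct_list[OF fin] by blast
  have len: "length ss = rank M" using ss rank distinct_card by fastforce
  have "\<exists>a. col M j = lincomb a S" if "j < m" for j
  proof -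
    have mem: "col M j \<in> set (cols M)" using that M by (metis carrier_matD(2) cols_length cols_nth nth_mem)
    have "col M j \<in> span S"
    proof (cases "col M j \<in> S")
      case True
      then show ?thesis using Sv span_mem by auto
    next
      case False
      show ?thesis
      proof (rule ccontr)
        assume "col M j \<notin> span S"
        then have "lin_indpt (S \<union> {col M j})"
          using lin_dep_iff_in_span[OF _ Sc(2) _ False] Sv mem cols by auto
        then show False using S mem Sc False unfolding maximal_def by blast
      qed
    qed
    then obtain a where "lincomb a S = col M j" using finite_in_span[OF fin, of "col M j"] Sv by auto
    then show ?thesis by (intro exI[of _ a]) (rule sym)
  qed
  then obtain a where a: "\<And>j. j < m \<Longrightarrow> col M j = lincomb (a j) S" by metis
  define P where "P = mat n (rank M) (\<lambda>(i,l). ss ! l $ i)"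
  define Q where "Q = mat (rank M) m (\<lambda>(l,j). a j (ss ! l))"
  have PQ: "P \<in> carrier_mat n (rank M)" "Q \<in> carrier_mat (rank M) m" by (simp_all add: P_def Q_def)
  have "M = P * Q"
  proof (rule eq_matI)
    fix i j assume "i < dim_row (P * Q)" "j < dim_col (P * Q)"
    then have ij: "i < n" "j < m" using PQ by auto
    have "M $$ (i,j) = (\<Sum>x\<in>S. a j x * x $ i)"
      using a[OF ij(2)] ij M lincomb_index[OF ij(1) Sv, of "a j"] by (metis carrier_matD index_col)
    also have "\<dots> = (\<Sum>l<rank M. a j (ss ! l) * (ss ! l) $ i)"
      unfolding len[symmetric] ss(1)[symmetric]
      by (rule sum.reindex_bij_betw[symmetric]) (rule bij_betw_nth[OF ss(2)], auto)
    also have "\<dots> = (P * Q) $$ (i,j)"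
      unfolding index_mult_mat_sum[OF PQ ij] using ij by (simp add: P_def Q_def mult.commute)
    finally show "M $$ (i,j) = (P * Q) $$ (i,j)" .
  qed (use PQ M in auto)
  then show thesis using that PQ by blast
qed

lemma rank_mult_le:
  fixes M :: "complex mat"
  assumes "A \<in> carrier_mat n n" "M \<in> carrier_mat n n" "B \<in> carrier_mat n n"
  shows "vec_space.rank n (A * M * B) \<le> vec_space.rank n M"
proof -
  obtain P Q where PQ: "P \<in> carrier_mat n (vec_space.rank n M)" "Q \<in> carrier_mat (vec_space.rank n M) n" "M = P * Q"
    using rank_factorization[OF assms(2)] by blast
  define r where "r = vec_space.rank n M"
  note PQ = PQ[folded r_def]
  have "A * M * B = (A * P) * (Q * B)"
    using assms PQ by (simp add: assoc_mult_mat[of _ n n _ r _ n] assoc_mult_mat[of _ n r _ n _ n]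
      mult_carrier_mat[of _ n r _ n] assoc_mult_mat[of _ n n _ n _ n])
  moreover have c: "A * P \<in> carrier_mat n r" "Q * B \<in> carrier_mat r n"
    using assms PQ by (auto simp: mult_carrier_mat[of _ n n] mult_carrier_mat[of _ r n])
  ultimately show ?thesis unfolding r_def[symmetric]
    using index_mult_mat_sum[OF c]
    by (intro rank_sum_outer_products[where m = n and p = "\<lambda>i l. (A * P) $$ (i,l)" and q = "\<lambda>l j. (Q * B) $$ (l,j)"])
       (auto simp: mult_carrier_mat[of _ n r] simp del: index_mult_mat(1))
qed

lemma rank_conj_by_le:
  assumes "U \<in> unitaries n" "M \<in> carrier_mat n n"
  shows "vec_space.rank n (conj_by U M) \<le> vec_space.rank n M"
  unfolding conj_by_def using unitariesD[OF assms(1)] assms(2) by (intro rank_mult_le)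

lemma rank_minus_swap:
  fixes A B :: "complex mat"
  assumes "A \<in> carrier_mat n n" "B \<in> carrier_mat n n"
  shows "vec_space.rank n (A - B) \<le> vec_space.rank n (B - A)"
proof -
  have c: "B - A \<in> carrier_mat n n" using assms by auto
  have "A - B = diagonal n (\<lambda>_. -1) * (B - A) * diagonal n (\<lambda>_. 1)"
    using assms c by (intro eq_matI)
      (auto simp: diagonal_one right_mult_one_mat[of _ n n] mult_carrier_mat[of _ n n]
        diagonal_mult_index[OF c] simp del: index_mult_mat(1))
  then show ?thesis using rank_mult_le[of "diagonal n (\<lambda>_. -1)" n "B - A" "diagonal n (\<lambda>_. 1)"] c by simp
qed

text \<open>Padding the equations by zero rows to a square matrix leaves at least one zero row, so
  the determinant vanishes and the kernel is nontrivial.\<close>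

lemma underdetermined_solution:
  fixes rs :: "complex vec list"
  assumes "length rs < n" "set rs \<subseteq> carrier_vec n"
  obtains y where "y \<in> carrier_vec n" "y \<noteq> 0\<^sub>v n" "\<And>r. r \<in> set rs \<Longrightarrow> r \<bullet> y = 0"
proof -
  define f where "f i = (if i < length rs then rs ! i else 0\<^sub>v n)" for i
  define M where "M = mat\<^sub>r n n f"
  have f: "f i \<in> carrier_vec n" for i using assms(2) by (auto simp: f_def)
  have "M = mat\<^sub>r n n (\<lambda>i. if i = length rs then 0\<^sub>v n else f i)"
    unfolding M_def by (intro eq_matI) (auto simp: f_def)
  then have "det M = 0" using det_row_0[of "length rs" n f] assms(1) f by auto
  moreover have M: "M \<in> carrier_mat n n" by (simp add: M_def)
  ultimately obtain y where y: "y \<in> carrier_vec n" "y \<noteq> 0\<^sub>v n" "M *\<^sub>v y = 0\<^sub>v n"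
    using det_0_iff_vec_prod_zero_field by blast
  have "rs ! i \<bullet> y = 0" if "i < length rs" for i
  proof -
    have "i < n" using that assms(1) by simp
    moreover have "row M i = rs ! i" using that \<open>i < n\<close> f[of i] by (simp add: M_def f_def)
    ultimately show ?thesis using arg_cong[OF y(3), of "\<lambda>v. v $ i"] M by simp
  qed
  then show thesis using that y by (metis in_set_conv_nth)
qed

lemma unitaries_norm:
  assumes T: "T \<in> unitaries n"
  shows "(\<Sum>i<n. (cmod (\<Sum>l<n. T $$ (i,l) * y l))\<^sup>2) = (\<Sum>i<n. (cmod (y i))\<^sup>2)"
proof -
  define Y where "Y = mat n 1 (\<lambda>(i,j). y i)"
  have Y: "Y \<in> carrier_mat n 1" by (simp add: Y_def)
  note Tc = unitariesD[OF T]
  have TY: "T * Y \<in> carrier_mat n 1" using Tc(1) Y by simp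
  have gram: "(mat_adjoint Z * Z) $$ (0,0) = of_real (\<Sum>i<n. (cmod (Z $$ (i,0)))\<^sup>2)"
    if Z: "Z \<in> carrier_mat n 1" for Z
    by (simp add: index_mult_mat_sum[OF mat_adjoint_carrier[OF Z] Z] index_mat_adjoint[OF Z] complex_norm_square mult.commute
      del: of_real_power index_mult_mat(1))
  have "mat_adjoint T * (T * Y) = Y"
    using Y Tc by (subst assoc_mult_mat[of _ n n _ n _ 1, symmetric]) auto
  then have "mat_adjoint (T * Y) * (T * Y) = mat_adjoint Y * Y"
    using Y Tc TY by (simp only: mat_adjoint_mult[OF Tc(1) Y] assoc_mult_mat[of _ 1 n _ n _ 1] mat_adjoint_carrier)
  then have "(\<Sum>i<n. (cmod ((T * Y) $$ (i,0)))\<^sup>2) = (\<Sum>i<n. (cmod (Y $$ (i,0)))\<^sup>2)"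
    using gram[OF TY] gram[OF Y] by (metis of_real_eq_iff)
  moreover have "(T * Y) $$ (i,0) = (\<Sum>l<n. T $$ (i,l) * y l)" if "i < n" for i
    using that by (subst index_mult_mat_sum[OF Tc(1) Y]) (auto simp: Y_def)
  moreover have "Y $$ (i,0) = y i" if "i < n" for i using that by (simp add: Y_def)
  ultimately show ?thesis by simp
qed

text \<open>The common vector \<open>x\<close> gives a contradiction through norms:
  \<open>A - a\<close> stretches it by at most \<open>r\<close>, as it is spanned by eigenvectors of
  \<open>A\<close> for the disc, while \<open>B - a\<close> stretches it by more than
  \<open>r\<close>, although \<open>A x = B x\<close>.\<close>

lemma disc_count_le_rank:
  fixes e f :: "nat \<Rightarrow> complex"
  assumes U: "U \<in> unitaries n" and W: "W \<in> unitaries n" and r: "r > 0"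
  defines "A \<equiv> conj_by U (diagonal n e)" and "B \<equiv> conj_by W (diagonal n f)"
  shows "card {i. i < n \<and> e i \<in> closed_disc a r}
    \<le> card {i. i < n \<and> f i \<in> closed_disc a r} + vec_space.rank n (A - B)"
proof (rule ccontr)
  let ?S = "closed_disc a r"
  assume neg: "\<not> ?thesis"
  note [simp] = unitariesD[OF U] unitariesD[OF W]
  note c = mult_carrier_mat[of _ n n]
  \<comment> \<open>The change of coordinates from the eigenbasis of \<open>A\<close> to that of
    \<open>B\<close>. Below, \<open>y\<close> and \<open>z\<close> are the coordinates of one vector
    in these two bases.\<close>
  define T where "T = mat_adjoint W * U"
  have T: "T \<in> unitaries n" unfolding T_def using U W by (intro mult_unitaries mat_adjoint_unitaries)
  note Tc = unitariesD[OF T]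
  define X where "X = mat_adjoint W * (A - B) * U"
  have AB: "A \<in> carrier_mat n n" "B \<in> carrier_mat n n" by (simp_all add: A_def B_def)
  have "mat_adjoint W * A * U = T * diagonal n e"
  proof -
    have "mat_adjoint W * A * U = T * diagonal n e * (mat_adjoint U * U)"
      unfolding A_def T_def conj_by_def by (simp only: assoc_mult_mat[of _ n n _ n _ n] c diagonal_carrier unitariesD(1,2)[OF U] unitariesD(1,2)[OF W])
    then show ?thesis using Tc by (simp add: c right_mult_one_mat[of _ n n])
  qed
  moreover have "mat_adjoint W * B * U = diagonal n f * T"
  proof -
    have "mat_adjoint W * B * U = (mat_adjoint W * W) * (diagonal n f * T)"
      unfolding B_def T_def conj_by_def by (simp only: assoc_mult_mat[of _ n n _ n _ n] c diagonal_carrier unitariesD(1,2)[OF U] unitariesD(1,2)[OF W])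
    then show ?thesis using Tc by (simp add: c left_mult_one_mat[of _ n n])
  qed
  ultimately have X_eq: "X = T * diagonal n e - diagonal n f * T"
    using AB by (simp add: X_def mult_minus_distrib_mat[of _ n n _ n] minus_mult_distrib_mat[of _ n n _ _ n] c)
  have X: "X \<in> carrier_mat n n" using AB by (auto simp: X_def intro!: mult_carrier_mat)
  define k where "k = vec_space.rank n X"
  have k: "k \<le> vec_space.rank n (A - B)"
    unfolding k_def X_def using AB by (intro rank_mult_le) auto
  obtain P Q where PQ: "P \<in> carrier_mat n k" "Q \<in> carrier_mat k n" "X = P * Q"
    using rank_factorization[OF X] unfolding k_def by blast
  \<comment> \<open>Linear conditions on \<open>y\<close>: no component of \<open>A\<close> outside
    the disc, no component of \<open>B\<close> inside it, and \<open>X y = 0\<close>, which says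
    that \<open>A\<close> and \<open>B\<close> agree on the vector. By the negated claim there are
    fewer than \<open>n\<close> of them.\<close>
  define rs where "rs = map (unit_vec n) (filter (\<lambda>i. e i \<notin> ?S) [0..<n])
    @ map (row T) (filter (\<lambda>i. f i \<in> ?S) [0..<n]) @ map (row Q) [0..<k]"
  have "{i. i < n \<and> e i \<notin> ?S} \<union> {i. i < n \<and> e i \<in> ?S} = {..<n}" by auto
  then have "card {i. i < n \<and> e i \<notin> ?S} + card {i. i < n \<and> e i \<in> ?S} = n"
    by (subst card_Un_disjoint[symmetric]) auto
  then have "length rs < n"
    using neg k by (simp add: rs_def length_filter_conv_card cong: conj_cong)
  moreover have "set rs \<subseteq> carrier_vec n" using Tc PQ by (auto simp: rs_def)
  ultimately obtain v where v: "v \<in> carrier_vec n" "v \<noteq> 0\<^sub>v n" "\<And>r. r \<in> set rs \<Longrightarrow> r \<bullet> v = 0"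
    using underdetermined_solution by blast
  define y where "y i = v $ i" for i
  define z where "z i = (\<Sum>l<n. T $$ (i,l) * y l)" for i
  have y0: "y i = 0" if "i < n" "e i \<notin> ?S" for i
    using v(3)[of "unit_vec n i"] that v(1) by (simp add: rs_def y_def)
  have z0: "z i = 0" if "i < n" "f i \<in> ?S" for i
    using v(3)[of "row T i"] that v(1) Tc(1)
    by (simp add: rs_def y_def z_def scalar_prod_def atLeast0LessThan)
  have Q0: "(\<Sum>j<n. Q $$ (l,j) * y j) = 0" if "l < k" for l
    using v(3)[of "row Q l"] that v(1) PQ(2)
    by (simp add: rs_def y_def scalar_prod_def atLeast0LessThan)
  have key: "(\<Sum>l<n. T $$ (i,l) * ((e l - a) * y l)) = (f i - a) * z i" if "i < n" for i
  proof -
    have "(\<Sum>j<n. X $$ (i,j) * y j) = (\<Sum>j<n. \<Sum>l<k. P $$ (i,l) * (Q $$ (l,j) * y j))"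
      using that by (simp add: PQ(3) index_mult_mat_sum[OF PQ(1,2)] sum_distrib_right sum_distrib_left mult_ac del: index_mult_mat(1))
    also have "\<dots> = (\<Sum>l<k. P $$ (i,l) * (\<Sum>j<n. Q $$ (l,j) * y j))"
      by (subst sum.swap) (simp add: sum_distrib_left)
    finally have "(\<Sum>j<n. X $$ (i,j) * y j) = 0" using Q0 by simp
    moreover have "X $$ (i,j) = T $$ (i,j) * e j - f i * T $$ (i,j)" if "j < n" for j
      using that \<open>i < n\<close> Tc(1) by (simp add: X_eq c del: index_mult_mat(1))
    ultimately have "(\<Sum>j<n. T $$ (i,j) * (e j * y j)) = f i * z i"
      by (simp add: algebra_simps sum_subtractf z_def sum_distrib_left)
    then show ?thesis by (simp add: algebra_simps sum_subtractf z_def sum_distrib_left)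
  qed
  have norm_eq: "(\<Sum>i<n. (cmod (z i))\<^sup>2) = (\<Sum>i<n. (cmod (y i))\<^sup>2)"
    unfolding z_def by (rule unitaries_norm[OF T])
  \<comment> \<open>The two sides are the squared norms of \<open>(B - a) x\<close> and
    \<open>(A - a) x\<close>, computed in the respective eigenbases.\<close>
  have "(\<Sum>i<n. (cmod ((f i - a) * z i))\<^sup>2) = (\<Sum>i<n. (cmod ((e i - a) * y i))\<^sup>2)"
    using unitaries_norm[OF T, of "\<lambda>i. (e i - a) * y i"] by (simp add: key)
  also have "\<dots> \<le> (\<Sum>i<n. r\<^sup>2 * (cmod (y i))\<^sup>2)"
  proof (rule sum_mono)
    fix i assume "i \<in> {..<n}"
    then have "y i = 0 \<or> cmod (e i - a) \<le> r" using y0 by (auto simp: closed_disc_def)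
    then show "(cmod ((e i - a) * y i))\<^sup>2 \<le> r\<^sup>2 * (cmod (y i))\<^sup>2"
      by (cases "y i = 0") (auto simp: norm_mult power_mult_distrib intro!: mult_right_mono power_mono)
  qed
  also have "\<dots> = (\<Sum>i<n. r\<^sup>2 * (cmod (z i))\<^sup>2)" using norm_eq by (simp flip: sum_distrib_left)
  finally have le: "(\<Sum>i<n. (cmod ((f i - a) * z i))\<^sup>2 - r\<^sup>2 * (cmod (z i))\<^sup>2) \<le> 0"
    by (simp add: sum_subtractf)
  have pos: "(cmod ((f i - a) * z i))\<^sup>2 - r\<^sup>2 * (cmod (z i))\<^sup>2 > 0" if "i < n" "z i \<noteq> 0" for i
  proof -
    have "r < cmod (f i - a)" using that z0 by (force simp: closed_disc_def)
    then have "r\<^sup>2 < (cmod (f i - a))\<^sup>2" using r by (intro power_strict_mono) auto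
    then show ?thesis using that by (simp add: norm_mult power_mult_distrib)
  qed
  have "z i = 0" if "i < n" for i
  proof (rule ccontr)
    assume "z i \<noteq> 0"
    have "0 < (\<Sum>i<n. (cmod ((f i - a) * z i))\<^sup>2 - r\<^sup>2 * (cmod (z i))\<^sup>2)"
    proof (rule sum_pos2[of _ i])
      show "0 \<le> (cmod ((f j - a) * z j))\<^sup>2 - r\<^sup>2 * (cmod (z j))\<^sup>2" if "j \<in> {..<n}" for j
        using pos[of j] that by (cases "z j = 0") auto
    qed (use pos that \<open>z i \<noteq> 0\<close> in auto)
    then show False using le by simp
  qed
  then have "(\<Sum>i<n. (cmod (y i))\<^sup>2) = 0" using norm_eq by simp
  then have "v = 0\<^sub>v n" using v(1) by (intro eq_vecI) (auto simp: sum_nonneg_eq_0_iff y_def)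
  then show False using v(2) by simp
qed

lemma card_eq_count_in:
  "card {i. i < length xs \<and> xs ! i \<in> S} = count_in (mset xs) S"
  by (simp add: count_in_def mset_filter[symmetric] length_filter_conv_card del: mset_filter)

text \<open>Since \<open>dc\<close> measures an excess on either side, the disc estimate is used in
  both orders; \<open>rank_minus_swap\<close> bounds the rank of \<open>B - A\<close> that arises in
  the second.\<close>

theorem dc_le_rank:
  assumes "A \<in> carrier_mat n n" "normal_mat A" "B \<in> carrier_mat n n" "normal_mat B"
  shows "dc (sp A) (sp B) \<le> vec_space.rank n (A - B)"
proof -
  obtain es fs where es: "mset es = sp A" and fs: "mset fs = sp B" by (meson ex_mset)
  have len: "length es = n" "length fs = n"
    using size_sp assms es fs by (metis size_mset)+
  obtain U W where U: "U \<in> unitaries n" "A = conj_by U (diagonal n (\<lambda>i. es ! i))"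
    and W: "W \<in> unitaries n" "B = conj_by W (diagonal n (\<lambda>i. fs ! i))"
    using normal_diagonalization[OF assms(1,2)] normal_diagonalization[OF assms(3,4)] es fs by metis
  have "\<bar>int (count_in (sp A) (closed_disc a r)) - int (count_in (sp B) (closed_disc a r))\<bar>
      \<le> int (vec_space.rank n (A - B))" if "r > 0" for a r
    using disc_count_le_rank[OF U(1) W(1) that, of "\<lambda>i. es ! i" a "\<lambda>i. fs ! i"]
      disc_count_le_rank[OF W(1) U(1) that, of "\<lambda>i. fs ! i" a "\<lambda>i. es ! i"] len
      card_eq_count_in[of es "closed_disc a r"] card_eq_count_in[of fs "closed_disc a r"]
      rank_minus_swap[OF assms(3,1)]
    by (simp add: es fs flip: U(2) W(2))
  then show ?thesis
    unfolding dc_def using finite_disc_diffs disc_diffs_nonempty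
    by (auto simp: disc_diffs_def nat_le_iff)
qed

subsection \<open>Counting functions of real multisets\<close>

definition num_le :: "real multiset \<Rightarrow> real \<Rightarrow> nat" where
  "num_le M t = size {#x \<in># M. x \<le> t#}"

definition num_less :: "real multiset \<Rightarrow> real \<Rightarrow> nat" where
  "num_less M t = size {#x \<in># M. x < t#}"

lemma num_le_union [simp]: "num_le (M + N) t = num_le M t + num_le N t"
  by (simp add: num_le_def)

lemma num_less_le: "num_le M t = num_less M t + count M t"
  by (induction M) (auto simp: num_le_def num_less_def)

text \<open>Counting functions are constant just to the left of \<open>x\<close>, so their left
  limits there are values. One \<open>t\<close> serves both multisets, so inequalities between
  \<open>num_le X\<close> and \<open>num_le Y\<close> carry over to \<open>num_less\<close>.\<close>

lemma num_less_eq_num_le: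
  obtains t where "num_less X x = num_le X t" "num_less Y x = num_le Y t"
proof -
  define t where "t = Max (insert (x - 1) {y \<in> set_mset (X + Y). y < x})"
  have t: "y < x \<longleftrightarrow> y \<le> t" if "y \<in># X + Y" for y
  proof -
    have "t < x" unfolding t_def by (subst Max_less_iff) auto
    moreover have "y \<le> t" if "y < x" using that \<open>y \<in># X + Y\<close> unfolding t_def by (intro Max_ge) auto
    ultimately show ?thesis by auto
  qed
  show thesis
    by (rule that[of t]) (use t in \<open>auto simp: num_less_def num_le_def intro!: arg_cong[of _ _ size] filter_mset_cong\<close>)
qed

lemma num_le_top:
  obtains t where "num_le X t = size X" "num_le Y t = size Y"
proof -
  define t where "t = Max (insert 0 (set_mset (X + Y)))"
  have "y \<le> t" if "y \<in># X + Y" for y using that unfolding t_def by (intro Max_ge) auto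
  then have "{#x \<in># X. x \<le> t#} = X" "{#x \<in># Y. x \<le> t#} = Y" by (auto simp: filter_mset_eq_conv)
  then show thesis using that[of t] by (simp add: num_le_def)
qed

lemma num_le_bot:
  obtains t where "num_le X t = 0" "num_le Y t = 0"
proof -
  define t where "t = Min (insert 0 (set_mset (X + Y))) - 1"
  have "\<not> y \<le> t" if "y \<in># X + Y" for y
  proof -
    have "Min (insert 0 (set_mset (X + Y))) \<le> y" using that by (intro Min_le) auto
    then show ?thesis by (simp add: t_def)
  qed
  then have "{#x \<in># X. x \<le> t#} = {#}" "{#x \<in># Y. x \<le> t#} = {#}" by (auto simp: filter_mset_eq_conv)
  then show thesis using that[of t] by (simp add: num_le_def)
qed

lemma num_le_le_size: "num_le M t \<le> size M"
  unfolding num_le_def by (rule size_filter_mset_lesseq)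

lemma num_le_inject:
  assumes "\<And>t. num_le X t = num_le Y t"
  shows "X = Y"
proof (rule multiset_eqI)
  fix x
  obtain t where "num_less X x = num_le X t" "num_less Y x = num_le Y t"
    by (rule num_less_eq_num_le)
  then show "count X x = count Y x"
    using num_less_le[of X x] num_less_le[of Y x] assms by simp
qed

text \<open>The right-hand side is a nondecreasing step function that is zero far to the left,
  because \<open>k\<close> is nonnegative, and so it is a counting function. The induction adds the
  points of the support in increasing order and reads off the jump at each.\<close>

lemma ex_multiset_num_le_min:
  "\<exists>Z. \<forall>t. num_le Z t = min (num_le X t) (num_le Y t + k)"
proof -
  have "set_mset X \<union> set_mset Y \<subseteq> L \<Longrightarrow> \<exists>Z. set_mset Z \<subseteq> L \<and> (\<forall>t. num_le Z t = min (num_le X t) (num_le Y t + k))"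
    if "finite L" for L X Y
    using that
  proof (induction L arbitrary: X Y rule: finite_linorder_max_induct)
    case empty
    then show ?case by (intro exI[of _ "{#}"]) (auto simp: num_le_def)
  next
    case (insert m L)
    define X' where "X' = {#x \<in># X. x < m#}"
    define Y' where "Y' = {#x \<in># Y. x < m#}"
    have "set_mset X' \<union> set_mset Y' \<subseteq> L" using insert.prems by (auto simp: X'_def Y'_def)
    from insert.IH[OF this] obtain Z where Z: "set_mset Z \<subseteq> L"
      "\<And>t. num_le Z t = min (num_le X' t) (num_le Y' t + k)" by blast
    have less: "num_le X' t = num_le X t" "num_le Y' t = num_le Y t" if "t < m" for t
      using that by (auto simp: X'_def Y'_def num_le_def filter_filter_mset intro!: arg_cong[of _ _ size] filter_mset_cong)
    have full: "num_le W t = size W" if "set_mset W \<subseteq> insert m L" "m \<le> t" for W t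
    proof -
      have "{#x \<in># W. x \<le> t#} = W" using that insert.hyps by (force simp: filter_mset_eq_conv)
      then show ?thesis by (simp add: num_le_def)
    qed
    \<comment> \<open>The jump at \<open>m\<close>. The subtraction on naturals is exact because
      \<open>size Z\<close> is the same minimum for the parts of \<open>X\<close> and
      \<open>Y\<close> below \<open>m\<close>.\<close>
    define j where "j = min (size X) (size Y + k) - size Z"
    have sizeZ: "size Z = min (size X') (size Y' + k)"
    proof -
      have "set_mset Z \<subseteq> insert m L" "set_mset X' \<subseteq> insert m L" "set_mset Y' \<subseteq> insert m L"
        using Z(1) insert.prems by (auto simp: X'_def Y'_def)
      from this[THEN full, OF order_refl] show ?thesis using Z(2)[of m] by simp
    qed
    have "size X' \<le> size X" "size Y' \<le> size Y" unfolding X'_def Y'_def by (rule size_filter_mset_lesseq)+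
    then have j: "size Z + j = min (size X) (size Y + k)" using sizeZ by (simp add: j_def)
    show ?case
    proof (intro exI conjI allI)
      show "set_mset (Z + replicate_mset j m) \<subseteq> insert m L" using Z(1) by (auto split: if_splits)
      fix t
      show "num_le (Z + replicate_mset j m) t = min (num_le X t) (num_le Y t + k)"
      proof (cases "t < m")
        case True
        then have "num_le (replicate_mset j m) t = 0" by (simp add: num_le_def)
        then show ?thesis using True Z(2) less by simp
      next
        case False
        then have "m \<le> t" by simp
        have "num_le (Z + replicate_mset j m) t = size (Z + replicate_mset j m)"
          using Z(1) \<open>m \<le> t\<close> by (intro full) (auto split: if_splits)
        moreover have "num_le X t = size X" "num_le Y t = size Y"
          using insert.prems \<open>m \<le> t\<close> by (auto intro: full)
        ultimately show ?thesis using j by simp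
      qed
    qed
  qed
  from this[of "set_mset X \<union> set_mset Y" X Y] show ?thesis by auto
qed

text \<open>A difference of two values of \<open>num_le\<close> counts a half-open interval, whereas
  discs cut out closed ones with distinct endpoints. The left end \<open>u\<close> is moved slightly
  to the right, before the next element of either multiset.\<close>

lemma dc_ge_interval:
  assumes disc: "\<And>s t. s < t \<Longrightarrow> \<exists>a r. r > 0 \<and> (\<forall>x. \<phi> x \<in> closed_disc a r \<longleftrightarrow> s \<le> x \<and> x \<le> t)"
    and "u < t"
  shows "\<bar>(int (num_le X t) - int (num_le Y t)) - (int (num_le X u) - int (num_le Y u))\<bar>
    \<le> int (dc (image_mset \<phi> X) (image_mset \<phi> Y))"
proof -
  \<comment> \<open>\<open>m\<close> is the first element above \<open>u\<close>, or
    \<open>t\<close> if that comes earlier; the midpoint \<open>s\<close> then lies strictly between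
    \<open>u\<close> and both \<open>t\<close> and the next element.\<close>
  define m where "m = Min (insert t {y \<in> set_mset (X + Y). u < y})"
  define s where "s = (u + m) / 2"
  have "m \<le> t" unfolding m_def by (intro Min_le) auto
  moreover have "u < m" unfolding m_def using \<open>u < t\<close> by (subst Min_gr_iff) auto
  ultimately have s: "u < s" "s < t" "s < m" by (auto simp: s_def field_simps)
  have su: "s \<le> y \<longleftrightarrow> u < y" if "y \<in># X + Y" for y
  proof -
    have "m \<le> y" if "u < y" using that \<open>y \<in># X + Y\<close> unfolding m_def by (intro Min_le) auto
    then show ?thesis using s by force
  qed
  obtain a r where ar: "r > 0" "\<And>x. \<phi> x \<in> closed_disc a r \<longleftrightarrow> s \<le> x \<and> x \<le> t"
    using disc[OF s(2)] by blast
  have cnt: "count_in (image_mset \<phi> Z) (closed_disc a r) + num_le Z u = num_le Z t"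
    if "Z = X \<or> Z = Y" for Z
  proof -
    have "count_in (image_mset \<phi> Z) (closed_disc a r) = size {#x \<in># Z. \<phi> x \<in> closed_disc a r#}"
      by (simp add: count_in_def filter_mset_image_mset)
    also have "{#x \<in># Z. \<phi> x \<in> closed_disc a r#} = {#x \<in># Z. u < x \<and> x \<le> t#}"
      using su that by (intro filter_mset_cong) (auto simp: ar)
    finally show ?thesis
      using \<open>u < t\<close> unfolding num_le_def
      by (simp add: size_union[symmetric] del: size_union)
         (rule arg_cong[of _ _ size], rule multiset_eqI, auto)
  qed
  have "nat \<bar>int (count_in (image_mset \<phi> X) (closed_disc a r)) - int (count_in (image_mset \<phi> Y) (closed_disc a r))\<bar>
      \<le> dc (image_mset \<phi> X) (image_mset \<phi> Y)"
    unfolding dc_def by (rule Max_ge[OF finite_disc_diffs]) (use ar(1) in \<open>auto simp: disc_diffs_def\<close>)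
  then have "\<bar>int (count_in (image_mset \<phi> X) (closed_disc a r)) - int (count_in (image_mset \<phi> Y) (closed_disc a r))\<bar>
      \<le> int (dc (image_mset \<phi> X) (image_mset \<phi> Y))"
    by (simp add: nat_le_iff)
  moreover have "num_le X t = count_in (image_mset \<phi> X) (closed_disc a r) + num_le X u"
    "num_le Y t = count_in (image_mset \<phi> Y) (closed_disc a r) + num_le Y u"
    using cnt[of X] cnt[of Y] by auto
  ultimately show ?thesis by simp
qed

text \<open>\<open>q\<close> is the maximum of \<open>F\<close> and \<open>p\<close> is minus its
  minimum. Their sum is the change of \<open>F\<close> between two points, which is an excess over
  one interval whichever of the points comes first.\<close>

lemma dc_num_le_bounds:
  assumes disc: "\<And>s t. s < t \<Longrightarrow> \<exists>a r. r > 0 \<and> (\<forall>x. \<phi> x \<in> closed_disc a r \<longleftrightarrow> s \<le> x \<and> x \<le> t)"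
  obtains p q where "p + q \<le> dc (image_mset \<phi> X) (image_mset \<phi> Y)"
    "\<And>t. num_le X t \<le> num_le Y t + q" "\<And>t. num_le Y t \<le> num_le X t + p"
proof -
  define F where "F t = int (num_le X t) - int (num_le Y t)" for t
  have "range F \<subseteq> {- int (size Y)..int (size X)}"
  proof
    fix y assume "y \<in> range F"
    then obtain t where "y = F t" by blast
    then show "y \<in> {- int (size Y)..int (size X)}"
      using num_le_le_size[of X t] num_le_le_size[of Y t] by (simp add: F_def)
  qed
  then have fin: "finite (range F)" by (rule finite_subset) simp
  have "Max (range F) \<in> range F" "Min (range F) \<in> range F" using fin by (auto intro: Max_in Min_in)
  then obtain t u where t: "Max (range F) = F t" and u: "Min (range F) = F u" by blast
  have Ft: "F v \<le> F t" and Fu: "F u \<le> F v" for v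
    unfolding t[symmetric] u[symmetric] using fin by auto
  \<comment> \<open>\<open>F\<close> vanishes to the left of all elements, so its maximum and
    minimum have the signs needed to turn them into natural numbers.\<close>
  obtain b where "num_le X b = 0" "num_le Y b = 0" by (rule num_le_bot)
  then have "F b = 0" by (simp add: F_def)
  then have sgn: "F u \<le> 0" "0 \<le> F t" using Ft[of b] Fu[of b] by auto
  have "\<bar>F t - F u\<bar> \<le> int (dc (image_mset \<phi> X) (image_mset \<phi> Y))"
  proof (cases u t rule: linorder_cases)
    case less
    then show ?thesis using dc_ge_interval[OF disc less, of X Y] by (simp add: F_def)
  next
    case greater
    then show ?thesis using dc_ge_interval[OF disc greater, of X Y] by (simp add: F_def)
  qed simp
  then have "nat (- F u) + nat (F t) \<le> dc (image_mset \<phi> X) (image_mset \<phi> Y)" using sgn by linarith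
  moreover have "num_le X v \<le> num_le Y v + nat (F t)" for v using Ft[of v] sgn unfolding F_def by linarith
  moreover have "num_le Y v \<le> num_le X v + nat (- F u)" for v using Fu[of v] sgn unfolding F_def by linarith
  ultimately show thesis using that by blast
qed

section \<open>Partial fractions and signs for interlacing sets\<close>

lemma sign_prod_diff:
  fixes s :: real
  assumes "finite A" "s \<notin> A"
  shows "0 < (-1) ^ card {a \<in> A. s < a} * (\<Prod>a\<in>A. s - a)"
  using assms
proof (induction A)
  case (insert a A)
  have IH: "0 < (-1) ^ card {a \<in> A. s < a} * (\<Prod>a\<in>A. s - a)" using insert by auto
  show ?case
  proof (cases "s < a")
    case True
    then have "{b \<in> insert a A. s < b} = insert a {b \<in> A. s < b}" by auto
    then show ?thesis using insert(1,2) mult_pos_pos[OF _ IH, of "a - s"] True by (simp add: algebra_simps)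
  next
    case False
    then have "{b \<in> insert a A. s < b} = {b \<in> A. s < b}" "a < s" using insert(4) by auto
    then show ?thesis using insert(1,2) mult_pos_pos[OF _ IH, of "s - a"] by (simp add: algebra_simps)
  qed
qed simp

text \<open>Lagrange interpolation: after clearing denominators the two sides differ by a polynomial
  that vanishes on \<open>S\<close>, by the choice of \<open>w\<close>, and has degree below
  \<open>card S\<close>. The assumption on \<open>w\<close> makes \<open>w s\<close> minus the
  residue at \<open>s\<close> of the product over \<open>T\<close> divided by that over
  \<open>S\<close>.\<close>

lemma interlacing_partial_fractions:
  fixes S T :: "real set" and x :: complex
  assumes fin: "finite S" "finite T" and card: "card S = card T"
    and w: "\<And>s. s \<in> S \<Longrightarrow> w s * (\<Prod>s'\<in>S - {s}. s - s') = - (\<Prod>t\<in>T. s - t)"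
    and x: "\<And>s. s \<in> S \<Longrightarrow> x \<noteq> of_real s"
  shows "(\<Prod>t\<in>T. x - of_real t) = (\<Prod>s\<in>S. x - of_real s) * (1 - (\<Sum>s\<in>S. of_real (w s) / (x - of_real s)))"
proof -
  define L :: "real \<Rightarrow> complex poly" where "L s = [:- of_real s, 1:]" for s
  define P where "P = (\<Prod>t\<in>T. L t) - (\<Prod>s\<in>S. L s) + (\<Sum>s\<in>S. smult (of_real (w s)) (\<Prod>s'\<in>S - {s}. L s'))"
  have deg: "degree (prod L A) = card A" "coeff (prod L A) (card A) = 1" if "finite A" for A
  proof -
    show d: "degree (prod L A) = card A"
      using that by (subst degree_prod_eq_sum_degree) (auto simp: L_def)
    have "lead_coeff (prod L A) = 1" by (subst lead_coeff_prod) (simp add: L_def)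
    then show "coeff (prod L A) (card A) = 1" by (simp add: d)
  qed
  have small: "degree (prod L (S - {s})) < card S" if "s \<in> S" for s
    using that fin deg(1)[of "S - {s}"] card_Diff1_less[OF fin(1) that] by simp
  have "P = 0"
  proof (rule ccontr)
    assume "P \<noteq> 0"
    have "poly P (of_real s) = 0" if s: "s \<in> S" for s
    proof -
      have z: "poly (\<Prod>s'\<in>S. L s') (of_real s) = 0"
        using s fin by (simp add: poly_prod L_def prod_zero_iff)
      have "(\<Sum>r\<in>S. poly (smult (of_real (w r)) (\<Prod>s'\<in>S - {r}. L s')) (of_real s))
          = poly (smult (of_real (w s)) (\<Prod>s'\<in>S - {s}. L s')) (of_real s)"
      proof (rule sum.remove[OF fin(1) s, THEN trans])
        have "(\<Sum>r\<in>S - {s}. poly (smult (of_real (w r)) (\<Prod>s'\<in>S - {r}. L s')) (of_real s)) = 0"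
        proof (rule sum.neutral, intro ballI)
          fix r assume "r \<in> S - {s}"
          then have "(\<Prod>s'\<in>S - {r}. of_real s - of_real s' :: complex) = 0"
            using s fin by (intro prod_zero) auto
          then show "poly (smult (of_real (w r)) (\<Prod>s'\<in>S - {r}. L s')) (of_real s) = 0"
            by (simp add: poly_prod L_def)
        qed
        then show "poly (smult (of_real (w s)) (prod L (S - {s}))) (of_real s) +
          (\<Sum>r\<in>S - {s}. poly (smult (of_real (w r)) (prod L (S - {r}))) (of_real s)) =
          poly (smult (of_real (w s)) (prod L (S - {s}))) (of_real s)" by simp
      qed
      also have "\<dots> = of_real (w s * (\<Prod>s'\<in>S - {s}. s - s'))"
        by (simp add: poly_prod L_def of_real_prod)
      also have "\<dots> = - poly (\<Prod>t\<in>T. L t) (of_real s)"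
        unfolding w[OF s] by (simp add: poly_prod L_def of_real_prod)
      finally show ?thesis using z by (simp add: P_def poly_sum)
    qed
    then have "complex_of_real ` S \<subseteq> {x. poly P x = 0}" by auto
    from card_mono[OF poly_roots_finite[OF \<open>P \<noteq> 0\<close>] this] have "card S \<le> card {x. poly P x = 0}"
      by (subst (asm) card_image) (auto simp: inj_on_def)
    also have "\<dots> \<le> degree P" by (rule card_poly_roots_bound[OF \<open>P \<noteq> 0\<close>])
    finally have "card S \<le> degree P" .
    moreover have "degree P \<le> card S"
      unfolding P_def using deg(1) fin card small
      by (intro degree_add_le degree_diff_le degree_sum_le degree_smult_le[THEN order_trans])
         (auto intro: less_imp_le)
    \<comment> \<open>Both products are monic of degree \<open>card S\<close>, so their leading
      terms cancel; this is where \<open>card S = card T\<close> enters.\<close>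
    moreover have "coeff P (card S) = 0"
      using deg(2)[OF fin(1)] deg(2)[OF fin(2)] card small
      by (simp add: P_def coeff_sum coeff_eq_0)
    ultimately have "lead_coeff P = 0" by simp
    then show False using \<open>P \<noteq> 0\<close> by simp
  qed
  have rem: "(\<Prod>s\<in>S. x - of_real s) * (of_real (w r) / (x - of_real r)) = of_real (w r) * (\<Prod>s\<in>S - {r}. x - of_real s)"
    if "r \<in> S" for r
    using prod.remove[OF fin(1) that, of "\<lambda>s. x - of_real s"] x[OF that] by simp
  have "poly P x = 0" by (simp add: \<open>P = 0\<close>)
  then have "(\<Prod>t\<in>T. x - of_real t) = (\<Prod>s\<in>S. x - of_real s) - (\<Sum>r\<in>S. of_real (w r) * (\<Prod>s\<in>S - {r}. x - of_real s))"
    by (simp add: P_def poly_sum poly_prod L_def algebra_simps)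
  also have "\<dots> = (\<Prod>s\<in>S. x - of_real s) * (1 - (\<Sum>s\<in>S. of_real (w s) / (x - of_real s)))"
    unfolding right_diff_distrib sum_distrib_left mult_1_right
    by (intro arg_cong2[of _ _ _ _ minus] refl sum.cong) (simp only: rem)
  finally show ?thesis .
qed

text \<open>After cancelling common elements, interlacing multisets are strictly alternating sets, and the
  residues of the quotient of the two characteristic polynomials are positive.\<close>

lemma interlacing_residues:
  fixes X Y :: "real multiset"
  assumes size: "size X = size Y" and inter: "\<And>t. num_le Y t \<le> num_le X t" "\<And>t. num_le X t \<le> num_le Y t + 1"
  obtains S T M w where "finite S" "finite T" "card S = card T" "X = mset_set S + M" "Y = mset_set T + M"
    "\<And>s. s \<in> S \<Longrightarrow> w s > 0"
    "\<And>s. s \<in> S \<Longrightarrow> w s * (\<Prod>s'\<in>S - {s}. s - s') = - (\<Prod>t\<in>T. s - t)"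
proof -
  define M where "M = X \<inter># Y"
  define S where "S = set_mset (X - Y)"
  define T where "T = set_mset (Y - X)"
  have XY: "X = (X - Y) + M" "Y = (Y - X) + M" 
    by (auto simp: M_def multiset_eq_iff)
  have lt: "num_less Y t \<le> num_less X t" "num_less X t \<le> num_less Y t + 1" for t
    by (rule num_less_eq_num_le[of X t Y], simp add: inter, rule num_less_eq_num_le[of X t Y], use inter(2) in simp)
  \<comment> \<open>The difference of the counting functions is 0 or 1 both at \<open>t\<close> and
    immediately to its left, so it jumps by at most one. Hence \<open>X - Y\<close> and
    \<open>Y - X\<close> have no repeated elements.\<close>
  have le: "count X t \<le> count Y t + 1" "count Y t \<le> count X t + 1" for t
    using inter[of t] lt[of t] num_less_le[of X t] num_less_le[of Y t] by linarith+
  have msX: "X - Y = mset_set S"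
  proof (rule multiset_eqI)
    fix t
    show "count (X - Y) t = count (mset_set S) t"
    proof (cases "t \<in># X - Y")
      case True
      then have "count (X - Y) t = 1" using le(1)[of t] by (simp add: in_diff_count)
      then show ?thesis using True by (simp add: S_def)
    next
      case False
      then show ?thesis by (simp add: S_def not_in_iff)
    qed
  qed
  have msY: "Y - X = mset_set T"
  proof (rule multiset_eqI)
    fix t
    show "count (Y - X) t = count (mset_set T) t"
    proof (cases "t \<in># Y - X")
      case True
      then have "count (Y - X) t = 1" using le(2)[of t] by (simp add: in_diff_count)
      then show ?thesis using True by (simp add: T_def)
    next
      case False
      then show ?thesis by (simp add: T_def not_in_iff)
    qed
  qed
  have fin: "finite S" "finite T" by (simp_all add: S_def T_def)
  have disj: "s \<notin> T" if "s \<in> S" for s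
    using that by (auto simp: S_def T_def in_diff_count)
  have card: "card S = card T"
  proof -
    have "size (X - Y) = size (Y - X)"
      using arg_cong[OF XY(1), of size] arg_cong[OF XY(2), of size] size by simp
    then show ?thesis by (simp add: msX msY)
  qed
  have numS: "num_le (mset_set A) t = card {a \<in> A. a \<le> t}" if "finite A" for A t
    using that by (simp add: num_le_def)
  define w where "w s = - (\<Prod>t\<in>T. s - t) / (\<Prod>s'\<in>S - {s}. s - s')" for s
  have nz: "(\<Prod>s'\<in>S - {s}. s - s') \<noteq> 0" if "s \<in> S" for s using fin by (auto simp: prod_zero_iff)
  have "w s > 0" if s: "s \<in> S" for s
  proof -
    \<comment> \<open>At an element of \<open>S\<close> the difference of the counting functions
      jumps up, which is possible only from 0 to 1.\<close>
    have "num_le X s = num_le Y s + 1"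
    proof -
      have "count X s \<ge> count Y s + 1" using s by (auto simp: S_def in_diff_count)
      then show ?thesis using inter(2)[of s] lt(1)[of s] num_less_le[of X s] num_less_le[of Y s] by linarith
    qed
    then have "num_le (mset_set S) s = num_le (mset_set T) s + 1"
      using arg_cong[OF XY(1), of "\<lambda>X. num_le X s"] arg_cong[OF XY(2), of "\<lambda>X. num_le X s"] by (simp add: msX msY)
    then have 1: "card {a \<in> S. a \<le> s} = card {a \<in> T. a \<le> s} + 1" using numS fin by simp
    have split: "card {a \<in> A. a \<le> s} + card {a \<in> A. s < a} = card A" if "finite A" for A
    proof -
      have "{a \<in> A. a \<le> s} \<union> {a \<in> A. s < a} = A" by auto
      then show ?thesis using that by (subst card_Un_disjoint[symmetric]) auto
    qed
    have eq: "{a \<in> S - {s}. s < a} = {a \<in> S. s < a}" by auto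
    \<comment> \<open>As \<open>S\<close> and \<open>T\<close> have equally many elements, the
      surplus up to \<open>s\<close> becomes a deficit above it. The two products in
      \<open>w s\<close> thus have opposite signs, and the minus sign in \<open>w\<close> makes the
      quotient positive.\<close>
    have c: "card {a \<in> T. s < a} = Suc (card {a \<in> S - {s}. s < a})"
      unfolding eq using split[OF fin(1)] split[OF fin(2)] 1 card by linarith
    let ?k = "card {a \<in> S - {s}. s < a}"
    have "0 < (-1) ^ ?k * (\<Prod>s'\<in>S - {s}. s - s')" using fin by (intro sign_prod_diff) auto
    moreover have "0 < (-1) ^ ?k * - (\<Prod>t\<in>T. s - t)"
      using sign_prod_diff[OF fin(2) disj[OF s]] unfolding c by simp
    ultimately have "0 < ((-1) ^ ?k * - (\<Prod>t\<in>T. s - t)) / ((-1) ^ ?k * (\<Prod>s'\<in>S - {s}. s - s'))"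
      by (rule divide_pos_pos[rotated])
    then show ?thesis unfolding w_def by (subst (asm) mult_divide_mult_cancel_left) auto
  qed
  moreover have "w s * (\<Prod>s'\<in>S - {s}. s - s') = - (\<Prod>t\<in>T. s - t)" if "s \<in> S" for s
    using nz[OF that] by (simp add: w_def)
  ultimately show thesis using that[OF fin card, of M w] XY msX msY by simp
qed

subsection \<open>Rank-one perturbations\<close>

text \<open>Both sides are the determinant of the bordered matrix with blocks \<open>E\<close>, \<open>V\<close>, \<open>W\<close> and \<open>1\<close>.\<close>

lemma det_minus_outer_product:
  fixes E F V W :: "complex mat"
  assumes E: "E \<in> carrier_mat n n" and F: "F \<in> carrier_mat n n" and EF: "E * F = 1\<^sub>m n"
    and V: "V \<in> carrier_mat n 1" and W: "W \<in> carrier_mat 1 n"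
  shows "det (E - V * W) = det E * (1 - (W * (F * V)) $$ (0,0))"
proof -
  let ?M = "four_block_mat E V W (1\<^sub>m 1)"
  have M: "?M \<in> carrier_mat (n + 1) (n + 1)" by (rule four_block_carrier_mat[OF E one_carrier_mat])
  have FV: "F * V \<in> carrier_mat n 1" "- (F * V) \<in> carrier_mat n 1" using F V by auto
  have VW: "V * W \<in> carrier_mat n n" using V W by simp
  have WFV: "W * (F * V) \<in> carrier_mat 1 1" using W FV by simp
  \<comment> \<open>Two block column eliminations of determinant one: \<open>?P\<close> clears
    \<open>W\<close> with the pivot \<open>1\<close>, and \<open>?Q\<close> clears \<open>V\<close>
    with the pivot \<open>E\<close>, whose inverse is \<open>F\<close>.\<close>
  let ?P = "four_block_mat (1\<^sub>m n) (0\<^sub>m n 1) (- W) (1\<^sub>m 1)"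
  let ?Q = "four_block_mat (1\<^sub>m n) (- (F * V)) (0\<^sub>m 1 n) (1\<^sub>m 1)"
  have "?M * ?P = four_block_mat (E - V * W) V (0\<^sub>m 1 n) (1\<^sub>m 1)"
  proof -
    have "E * 1\<^sub>m n + V * (- W) = E - V * W" "E * 0\<^sub>m n 1 + V * 1\<^sub>m 1 = V"
      "W * 1\<^sub>m n + 1\<^sub>m 1 * (- W) = 0\<^sub>m 1 n" "W * 0\<^sub>m n 1 + 1\<^sub>m 1 * 1\<^sub>m 1 = 1\<^sub>m 1"
      using E V W VW by (simp_all add: uminus_mult_right_mat add_uminus_minus_mat[of _ n n] add_uminus_minus_mat[of _ 1 n])
    then show ?thesis
      using mult_four_block_mat[OF E V W one_carrier_mat one_carrier_mat zero_carrier_mat _ one_carrier_mat, of "- W"] W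
      by simp
  qed
  moreover have "det ?P = 1" using W by (subst det_four_block_mat_upper_right_zero[of _ n _ 1]) auto
  moreover have "det (?M * ?P) = det ?M * det ?P" using M W by (intro det_mult[of _ "n + 1"]) auto
  moreover have "det (four_block_mat (E - V * W) V (0\<^sub>m 1 n) (1\<^sub>m 1)) = det (E - V * W)"
    using det_four_block_mat_lower_left_zero[OF minus_carrier_mat[OF VW] V refl one_carrier_mat] by simp
  ultimately have 1: "det ?M = det (E - V * W)" by simp
  have EFV: "E * (F * V) = V"
    using assms by (subst assoc_mult_mat[of _ n n _ n _ 1, symmetric]) auto
  have "?M * ?Q = four_block_mat E (0\<^sub>m n 1) W (1\<^sub>m 1 - W * (F * V))"
  proof -
    have "E * 1\<^sub>m n + V * 0\<^sub>m 1 n = E" "E * (- (F * V)) + V * 1\<^sub>m 1 = 0\<^sub>m n 1"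
      "W * 1\<^sub>m n + 1\<^sub>m 1 * 0\<^sub>m 1 n = W" "W * (- (F * V)) + 1\<^sub>m 1 * 1\<^sub>m 1 = 1\<^sub>m 1 - W * (F * V)"
      using E F V W FV(1) WFV EFV
      by (simp_all add: comm_add_mat[of "- (W * (F * V))" "Suc 0" "Suc 0"] add_uminus_minus_mat[of _ "Suc 0" "Suc 0"])
    then show ?thesis
      using mult_four_block_mat[OF E V W one_carrier_mat one_carrier_mat FV(2) zero_carrier_mat one_carrier_mat]
      by simp
  qed
  moreover have "det ?Q = 1" using FV by (subst det_four_block_mat_lower_left_zero[of _ n _ 1]) auto
  moreover have "det (?M * ?Q) = det ?M * det ?Q" using M FV by (intro det_mult[of _ "n + 1"]) auto
  moreover have "det (four_block_mat E (0\<^sub>m n 1) W (1\<^sub>m 1 - W * (F * V))) = det E * det (1\<^sub>m 1 - W * (F * V))"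
    using E W minus_carrier_mat[OF WFV] by (subst det_four_block_mat_upper_right_zero[of _ n _ 1]) auto
  moreover have "det (1\<^sub>m 1 - W * (F * V)) = 1 - (W * (F * V)) $$ (0,0)"
    using V W minus_carrier_mat[OF WFV] by (subst det_single) auto
  ultimately show ?thesis using 1 by simp
qed

text \<open>The last factor is the secular function of the perturbation. Keeping \<open>x\<close>
  off the diagonal entries makes \<open>x - D\<close> invertible; the infinitely many remaining
  points suffice to identify the polynomial.\<close>

lemma poly_char_poly_diagonal_rank_one:
  fixes d v :: "nat \<Rightarrow> complex"
  assumes x: "\<And>i. i < n \<Longrightarrow> x \<noteq> d i"
  defines "B \<equiv> mat n n (\<lambda>(i,j). (if i = j then d i else 0) + v i * v j)"
  shows "poly (char_poly B) x = (\<Prod>i<n. x - d i) * (1 - (\<Sum>i<n. (v i)\<^sup>2 / (x - d i)))"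
proof -
  define V where "V = mat n 1 (\<lambda>(i,j). v i)"
  define W where "W = mat 1 n (\<lambda>(i,j). v j)"
  define E where "E = diagonal n (\<lambda>i. x - d i)"
  define F where "F = diagonal n (\<lambda>i. 1 / (x - d i))"
  have B: "B \<in> carrier_mat n n" by (simp add: B_def)
  have V: "V \<in> carrier_mat n 1" and W: "W \<in> carrier_mat 1 n" by (simp_all add: V_def W_def)
  have "E * F = diagonal n (\<lambda>_. 1)"
    unfolding E_def F_def diagonal_mult using x by (intro diagonal_cong) simp
  then have EF: "E * F = 1\<^sub>m n" by (simp add: diagonal_one)
  have "- (char_matrix B x) = E - V * W"
  proof (rule eq_matI)
    fix i j assume "i < dim_row (E - V * W)" "j < dim_col (E - V * W)"
    then have ij: "i < n" "j < n" using V W by auto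
    have "(V * W) $$ (i,j) = v i * v j"
      by (subst index_mult_mat_sum[OF V W ij]) (use ij in \<open>simp add: V_def W_def\<close>)
    then show "(- (char_matrix B x)) $$ (i,j) = (E - V * W) $$ (i,j)"
      using ij V W B by (simp add: char_matrix_def E_def B_def del: index_mult_mat(1))
  qed (use V W B in \<open>auto simp: char_matrix_def\<close>)
  then have "poly (char_poly B) x = det (E - V * W)" by (simp add: char_poly_matrix[OF B])
  also have "\<dots> = det E * (1 - (W * (F * V)) $$ (0,0))"
    by (rule det_minus_outer_product[OF _ _ EF V W]) (simp_all add: E_def F_def)
  also have "det E = (\<Prod>i<n. x - d i)"
    unfolding E_def by (subst det_upper_triangular[of _ n])
      (auto simp: upper_triangular_def diag_mat_def prod.list_conv_set_nth atLeast0LessThan)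
  also have "(W * (F * V)) $$ (0,0) = (\<Sum>i<n. (v i)\<^sup>2 / (x - d i))"
  proof -
    have FV: "F * V \<in> carrier_mat n 1" using V by (simp add: F_def mult_carrier_mat[of _ n n])
    have "(F * V) $$ (i,0) = v i / (x - d i)" if "i < n" for i
      using that unfolding F_def by (subst diagonal_mult_index[OF V]) (auto simp: V_def)
    then show ?thesis
      by (subst index_mult_mat_sum[OF W FV]) (auto intro!: sum.cong simp: W_def power2_eq_square)
  qed
  finally show ?thesis .
qed

lemma poly_eqI_infinite:
  fixes p q :: "'a::idom poly"
  assumes "infinite S" "\<And>x. x \<in> S \<Longrightarrow> poly p x = poly q x"
  shows "p = q"
proof (rule ccontr)
  assume "p \<noteq> q"
  then have "finite {x. poly (p - q) x = 0}" by (intro poly_roots_finite) simp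
  moreover have "S \<subseteq> {x. poly (p - q) x = 0}" using assms(2) by auto
  ultimately show False using assms(1) finite_subset by blast
qed

text \<open>A relation between spectra rather than matrices: with both matrices existentially
  quantified, each rank-one step may use its own diagonal representative.\<close>

definition rank_close :: "nat \<Rightarrow> nat \<Rightarrow> real multiset \<Rightarrow> real multiset \<Rightarrow> bool" where
  "rank_close n k X Y \<longleftrightarrow> (\<exists>A \<in> carrier_mat n n. \<exists>B \<in> carrier_mat n n.
     mat_adjoint A = A \<and> mat_adjoint B = B \<and> sp A = image_mset of_real X \<and> sp B = image_mset of_real Y \<and>
     vec_space.rank n (A - B) \<le> k)"

text \<open>The diagonal entries of \<open>D\<close> are the elements of \<open>X\<close>, those of
  \<open>S\<close> first. The vector \<open>v\<close> is zero on the part \<open>M\<close> shared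
  with \<open>Y\<close>, so these eigenvalues persist; on \<open>S\<close> the squares of its
  entries are the weights \<open>w\<close>.\<close>

lemma rank_close_interlacing:
  assumes "size X = n" "size Y = n" "\<And>t. num_le Y t \<le> num_le X t" "\<And>t. num_le X t \<le> num_le Y t + 1"
  shows "rank_close n 1 X Y"
proof -
  obtain S T M w where fin: "finite S" "finite T" and card: "card S = card T"
    and XY: "X = mset_set S + M" "Y = mset_set T + M" and w_pos: "\<And>s. s \<in> S \<Longrightarrow> w s > 0"
    and w: "\<And>s. s \<in> S \<Longrightarrow> w s * (\<Prod>s'\<in>S - {s}. s - s') = - (\<Prod>t\<in>T. s - t)"
    using interlacing_residues[of X Y] assms by metis
  obtain ss where ss: "set ss = S" "distinct ss" using finite_distinct_list[OF fin(1)] by blast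
  obtain ms where ms: "mset ms = M" by (meson ex_mset)
  define es where "es = ss @ ms"
  define k where "k = length ss"
  have mset_es: "mset es = X" using ss ms by (auto simp: es_def XY mset_set_set)
  have len: "length es = n" using assms(1) mset_es by (metis size_mset)
  have k: "k \<le> n" using len by (simp add: k_def es_def)
  define d where "d i = complex_of_real (es ! i)" for i
  define v where "v i = (if i < k then complex_of_real (sqrt (w (ss ! i))) else 0)" for i
  define B where "B = mat n n (\<lambda>(i,j). (if i = j then d i else 0) + v i * v j)"
  have B: "B \<in> carrier_mat n n" by (simp add: B_def)
  have "cnj (B $$ (j,i)) = B $$ (i,j)" if "i < n" "j < n" for i j
    using that by (simp add: B_def d_def v_def)
  then have B_adj: "mat_adjoint B = B"
    by (intro eq_matI) (use B carrier_matD[OF mat_adjoint_carrier[OF B]] in \<open>auto simp: index_mat_adjoint[OF B]\<close>)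
  have one: "1\<^sub>m n \<in> unitaries n" by (rule unitariesI) auto
  have "sp (conj_by (1\<^sub>m n) (diagonal n (\<lambda>i. map complex_of_real es ! i))) = mset (map of_real es)"
    by (rule sp_conj_by_diagonal[OF one]) (simp add: len)
  moreover have "diagonal n (\<lambda>i. map complex_of_real es ! i) = diagonal n d"
    by (rule diagonal_cong) (simp add: d_def len)
  ultimately have spA: "sp (diagonal n d) = image_mset of_real X" using mset_es by simp
  have "char_poly B = (\<Prod>y\<in>#image_mset of_real Y. [:- y, 1:])"
  proof (rule poly_eqI_infinite)
    \<comment> \<open>The secular formula is available only off the spectrum of \<open>D\<close>,
      and this cofinite set is large enough to compare polynomials.\<close>
    show "infinite (- (complex_of_real ` set es))"
      by (simp add: Compl_eq_Diff_UNIV Diff_infinite_finite infinite_UNIV_char_0)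
    fix x assume x: "x \<in> - (complex_of_real ` set es)"
    then have xd: "x \<noteq> d i" if "i < n" for i using that len by (auto simp: d_def)
    have xS: "x \<noteq> of_real s" if "s \<in> S" for s using that x ss by (auto simp: es_def)
    have "(\<Prod>i<n. x - d i) = (\<Prod>e\<leftarrow>es. x - of_real e)"
      by (simp add: d_def prod.list_conv_set_nth len atLeast0LessThan)
    also have "\<dots> = (\<Prod>s\<in>S. x - of_real s) * (\<Prod>m\<in>#M. x - of_real m)"
      using prod.distinct_set_conv_list[OF ss(2), of "\<lambda>e. x - complex_of_real e"]
      by (simp add: es_def ss flip: ms prod_mset_prod_list)
    finally have p: "(\<Prod>i<n. x - d i) = (\<Prod>s\<in>S. x - of_real s) * (\<Prod>m\<in>#M. x - of_real m)" .
    have "(\<Sum>i<n. (v i)\<^sup>2 / (x - d i)) = (\<Sum>i<k. (v i)\<^sup>2 / (x - d i))"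
      using k by (intro sum.mono_neutral_right) (auto simp: v_def)
    also have "\<dots> = (\<Sum>i<k. of_real (w (ss ! i)) / (x - of_real (ss ! i)))"
    proof (intro sum.cong refl)
      fix i assume "i \<in> {..<k}"
      then have i: "i < length ss" by (simp add: k_def)
      then have "w (ss ! i) > 0" using w_pos ss by auto
      then show "(v i)\<^sup>2 / (x - d i) = of_real (w (ss ! i)) / (x - of_real (ss ! i))"
        using i by (simp add: v_def d_def es_def nth_append k_def flip: of_real_power)
    qed
    also have "\<dots> = (\<Sum>s\<in>S. of_real (w s) / (x - of_real s))"
      unfolding k_def by (rule sum.reindex_bij_betw) (rule bij_betw_nth[OF ss(2)], auto simp: ss)
    finally have "poly (char_poly B) x
        = (\<Prod>s\<in>S. x - of_real s) * (\<Prod>m\<in>#M. x - of_real m) * (1 - (\<Sum>s\<in>S. of_real (w s) / (x - of_real s)))"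
      unfolding B_def using poly_char_poly_diagonal_rank_one[where v = v, OF xd] p by simp
    also have "\<dots> = (\<Prod>t\<in>T. x - of_real t) * (\<Prod>m\<in>#M. x - of_real m)"
      using interlacing_partial_fractions[OF fin card w xS] by simp
    also have "\<dots> = poly (\<Prod>y\<in>#image_mset of_real Y. [:- y, 1:]) x"
      by (simp add: XY poly_prod_mset image_mset.compositionality o_def prod_unfold_prod_mset)
    finally show "poly (char_poly B) x = poly (\<Prod>y\<in>#image_mset of_real Y. [:- y, 1:]) x" .
  qed
  then have spB: "sp B = image_mset of_real Y" using sp_eq_iff[OF B] by simp
  have "vec_space.rank n (diagonal n d - B) \<le> 1"
    by (rule rank_sum_outer_products[where m = n and p = "\<lambda>i l. - v i" and q = "\<lambda>l j. v j"])
      (auto simp: B_def)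
  moreover have "mat_adjoint (diagonal n d) = diagonal n d"
    unfolding mat_adjoint_diagonal by (rule diagonal_cong) (simp add: d_def)
  ultimately show ?thesis
    unfolding rank_close_def using B B_adj spA spB by (meson diagonal_carrier)
qed

section \<open>Chaining perturbations of self-adjoint matrices\<close>

lemma rank_close_sym:
  assumes "rank_close n k X Y"
  shows "rank_close n k Y X"
proof -
  obtain A B where A: "A \<in> carrier_mat n n" "mat_adjoint A = A" "sp A = image_mset of_real X"
    and B: "B \<in> carrier_mat n n" "mat_adjoint B = B" "sp B = image_mset of_real Y"
    and AB: "vec_space.rank n (A - B) \<le> k"
    using assms unfolding rank_close_def by blast
  have "vec_space.rank n (B - A) \<le> k" by (rule order_trans[OF rank_minus_swap[OF B(1) A(1)] AB])
  then show ?thesis unfolding rank_close_def using A B by blast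
qed

lemma self_adjoint_normal: "mat_adjoint A = A \<Longrightarrow> normal_mat A"
  by (simp add: normal_mat_def)

lemma rank_close_refl:
  assumes "size X = n"
  shows "rank_close n 0 X X"
proof -
  obtain xs where xs: "mset xs = X" by (meson ex_mset)
  then have len: "length xs = n" using assms by (metis size_mset)
  define A where "A = diagonal n (\<lambda>i. map complex_of_real xs ! i)"
  have one: "1\<^sub>m n \<in> unitaries n" by (rule unitariesI) auto
  have "sp A = image_mset of_real X"
    using sp_conj_by_diagonal[OF one, of "map of_real xs"] len xs by (simp add: A_def)
  moreover have "mat_adjoint A = A"
    unfolding A_def mat_adjoint_diagonal by (rule diagonal_cong) (simp add: len)
  moreover have "A - A = 0\<^sub>m n n" by (intro eq_matI) (auto simp: A_def)
  moreover have "A \<in> carrier_mat n n" by (simp add: A_def)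
  ultimately show ?thesis unfolding rank_close_def by (metis vec_space.rank_0I order_refl)
qed

text \<open>The two representatives \<open>B\<close> and \<open>B'\<close> of \<open>Y\<close> need
  not coincide. Diagonalised with the same list they are seen to be conjugate by \<open>V\<close>;
  conjugating the second pair by \<open>V\<close> makes them equal, and subadditivity of rank
  applies.\<close>

lemma rank_close_trans:
  assumes "rank_close n k X Y" "rank_close n l Y Z"
  shows "rank_close n (k + l) X Z"
proof -
  obtain A B where A: "A \<in> carrier_mat n n" "mat_adjoint A = A" "sp A = image_mset of_real X"
    and B: "B \<in> carrier_mat n n" "mat_adjoint B = B" "sp B = image_mset of_real Y"
    and AB: "vec_space.rank n (A - B) \<le> k"
    using assms(1) unfolding rank_close_def by blast
  obtain B' C where B': "B' \<in> carrier_mat n n" "mat_adjoint B' = B'" "sp B' = image_mset of_real Y"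
    and C: "C \<in> carrier_mat n n" "mat_adjoint C = C" "sp C = image_mset of_real Z"
    and BC: "vec_space.rank n (B' - C) \<le> l"
    using assms(2) unfolding rank_close_def by blast
  obtain ys where ys: "mset ys = image_mset complex_of_real Y" by (meson ex_mset)
  obtain U where U: "U \<in> unitaries n" "B = conj_by U (diagonal n (\<lambda>i. ys ! i))"
    using normal_diagonalization[OF B(1) self_adjoint_normal[OF B(2)]] B(3) ys by metis
  obtain W where W: "W \<in> unitaries n" "B' = conj_by W (diagonal n (\<lambda>i. ys ! i))"
    using normal_diagonalization[OF B'(1) self_adjoint_normal[OF B'(2)]] B'(3) ys by metis
  define V where "V = U * mat_adjoint W"
  have V: "V \<in> unitaries n" unfolding V_def using U W by (intro mult_unitaries mat_adjoint_unitaries)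
  have "conj_by (mat_adjoint W) B' = diagonal n (\<lambda>i. ys ! i)"
    unfolding W(2) using W(1) by (intro conj_by_inverse) auto
  then have B_eq: "B = conj_by V B'"
    unfolding V_def using U B'(1) unitariesD[OF U(1)] unitariesD[OF W(1)]
    by (simp add: conj_by_conj_by[of _ n, symmetric])
  define C' where "C' = conj_by V C"
  have C': "C' \<in> carrier_mat n n" using C unitariesD[OF V] by (simp add: C'_def)
  have "A - C' = (A - B) + conj_by V (B' - C)"
    using A B C C' B' unitariesD[OF V] by (simp add: conj_by_minus[of _ n] flip: B_eq C'_def) (intro eq_matI, auto)
  then have "vec_space.rank n (A - C') \<le> vec_space.rank n (A - B) + vec_space.rank n (conj_by V (B' - C))"
    using vec_space.rank_subadditive[of "A - B" n n "conj_by V (B' - C)"] B C unitariesD[OF V]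
    by (simp add: minus_carrier_mat)
  also have "vec_space.rank n (conj_by V (B' - C)) \<le> l"
    using order_trans[OF rank_conj_by_le[OF V, of "B' - C"] BC] C by (simp add: minus_carrier_mat)
  finally have "vec_space.rank n (A - C') \<le> k + l" using AB by simp
  moreover have "mat_adjoint C' = C'"
    using C unitariesD[OF V] by (simp add: C'_def mat_adjoint_conj_by[of _ n])
  moreover have "sp C' = sp C" using C by (simp add: sp_def C'_def char_poly_conj_by[OF V])
  ultimately show ?thesis unfolding rank_close_def using A C C' by metis
qed

text \<open>Replacing the bound \<open>Suc q\<close> by \<open>q\<close> lowers the counting
  function by at most one, so \<open>Z\<close> interlaces \<open>X\<close>. Far to the right the
  minimum is \<open>min n (n + q)\<close>, hence no element is lost.\<close>

lemma interlacing_intermediate: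
  assumes "size X = n" "size Y = n" "\<And>t. num_le X t \<le> num_le Y t + Suc q"
  obtains Z where "size Z = n" "rank_close n 1 X Z" "\<And>t. num_le Z t = min (num_le X t) (num_le Y t + q)"
proof -
  obtain Z where Z: "\<And>t. num_le Z t = min (num_le X t) (num_le Y t + q)"
    using ex_multiset_num_le_min by metis
  obtain t where t: "num_le (X + Y) t = size (X + Y)" "num_le Z t = size Z" by (rule num_le_top)
  then have "size Z = n" using Z[of t] num_le_le_size[of X t] num_le_le_size[of Y t] assms(1,2) by simp
  moreover have "rank_close n 1 X Z"
  proof (rule rank_close_interlacing)
    show "num_le Z t \<le> num_le X t" "num_le X t \<le> num_le Z t + 1" for t
      using assms(3)[of t] by (auto simp: Z)
  qed fact+
  ultimately show thesis using that Z by blast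
qed

lemma rank_close_dominating:
  assumes "size X = n" "size Y = n" "\<And>t. num_le Y t \<le> num_le X t" "\<And>t. num_le X t \<le> num_le Y t + q"
  shows "rank_close n q X Y"
  using assms
proof (induction q arbitrary: X)
  case 0
  then have "X = Y" by (intro num_le_inject) (metis add_0_right le_antisym)
  then show ?case using 0(2) rank_close_refl[of Y n] by simp
next
  case (Suc q)
  from interlacing_intermediate[OF Suc.prems(1,2,4)] obtain Z where Z: "size Z = n" "rank_close n 1 X Z"
    "\<And>t. num_le Z t = min (num_le X t) (num_le Y t + q)" by blast
  have "rank_close n q Z Y" using Suc.prems(2,3) Z(1) by (intro Suc.IH) (simp_all add: Z(3))
  then show ?case using rank_close_trans[OF Z(2)] by simp
qed

text \<open>Each truncation lowers the excess of \<open>X\<close> over \<open>Y\<close> by one and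
  respects the bound \<open>p\<close> on the opposite excess. Once \<open>X\<close> has no excess
  left, the roles are exchanged and the dominating case handles \<open>p\<close>.\<close>

lemma rank_close_num_le:
  assumes "size X = n" "size Y = n" "\<And>t. num_le X t \<le> num_le Y t + q" "\<And>t. num_le Y t \<le> num_le X t + p"
  shows "rank_close n (p + q) X Y"
  using assms
proof (induction q arbitrary: X)
  case 0
  then have "rank_close n p Y X" by (intro rank_close_dominating) auto
  then show ?case by (simp add: rank_close_sym)
next
  case (Suc q)
  from interlacing_intermediate[OF Suc.prems(1-3)] obtain Z where Z: "size Z = n" "rank_close n 1 X Z"
    "\<And>t. num_le Z t = min (num_le X t) (num_le Y t + q)" by blast
  have "num_le Y t \<le> num_le Z t + p" for t using Suc.prems(4)[of t] by (simp add: Z(3))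
  then have "rank_close n (p + q) Z Y" using Suc.prems(2) Z(1) by (intro Suc.IH) (auto simp: Z(3))
  then show ?case using rank_close_trans[OF Z(2)] by simp
qed

text \<open>The identity assumed for \<open>\<phi>\<close> makes the rank of a difference of normal matrices with spectra in
  the range of \<open>\<phi>\<close> at most that of the difference of the corresponding self-adjoint matrices.\<close>

lemma normal_perturbation:
  fixes \<phi> \<alpha> \<beta> :: "real \<Rightarrow> complex"
  assumes A: "A \<in> carrier_mat n n" "normal_mat A" "sp A = image_mset \<phi> X" and Y: "size Y = n"
    and disc: "\<And>s t. s < t \<Longrightarrow> \<exists>a r. r > 0 \<and> (\<forall>x. \<phi> x \<in> closed_disc a r \<longleftrightarrow> s \<le> x \<and> x \<le> t)"
    and diff: "\<And>x y. \<phi> x - \<phi> y = \<alpha> x * of_real (x - y) * \<beta> y"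
  obtains W ys where "W \<in> unitaries n" "length ys = n" "mset ys = Y"
    "vec_space.rank n (A - conj_by W (diagonal n (\<lambda>i. \<phi> (ys ! i)))) = dc (sp A) (image_mset \<phi> Y)"
proof -
  let ?d = "dc (image_mset \<phi> X) (image_mset \<phi> Y)"
  have X: "size X = n" using size_sp[OF A(1)] A(3) by simp
  obtain p q where "p + q \<le> ?d" and "\<And>t. num_le X t \<le> num_le Y t + q" "\<And>t. num_le Y t \<le> num_le X t + p"
    using dc_num_le_bounds[OF disc] by metis
  with rank_close_num_le[OF X Y] obtain H K where H: "H \<in> carrier_mat n n" "mat_adjoint H = H" "sp H = image_mset of_real X"
    and K: "K \<in> carrier_mat n n" "mat_adjoint K = K" "sp K = image_mset of_real Y"
    and HK: "vec_space.rank n (H - K) \<le> ?d"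
    unfolding rank_close_def by (meson order_trans)
  obtain xs ys where xs: "mset xs = X" and ys: "mset ys = Y" by (meson ex_mset)
  have len: "length xs = n" "length ys = n" using X Y xs ys by (metis size_mset)+
  obtain U where U: "U \<in> unitaries n" "H = conj_by U (diagonal n (\<lambda>i. map complex_of_real xs ! i))"
    using normal_diagonalization[OF H(1) self_adjoint_normal[OF H(2)]] H(3) xs by (metis mset_map)
  obtain V where V: "V \<in> unitaries n" "K = conj_by V (diagonal n (\<lambda>i. map complex_of_real ys ! i))"
    using normal_diagonalization[OF K(1) self_adjoint_normal[OF K(2)]] K(3) ys by (metis mset_map)
  obtain G where G: "G \<in> unitaries n" "A = conj_by G (diagonal n (\<lambda>i. map \<phi> xs ! i))"
    using normal_diagonalization[OF A(1,2)] A(3) xs by (metis mset_map)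
  have U2: "H = conj_by U (diagonal n (\<lambda>i. of_real (xs ! i)))"
    unfolding U(2) using len by (intro arg_cong[of _ _ "conj_by U"] diagonal_cong) simp
  have V2: "K = conj_by V (diagonal n (\<lambda>i. of_real (ys ! i)))"
    unfolding V(2) using len by (intro arg_cong[of _ _ "conj_by V"] diagonal_cong) simp
  have G2: "A = conj_by G (diagonal n (\<lambda>i. \<phi> (xs ! i)))"
    unfolding G(2) using len by (intro arg_cong[of _ _ "conj_by G"] diagonal_cong) simp
  \<comment> \<open>\<open>T\<close> is the position of the eigenbasis of \<open>K\<close> relative
    to that of \<open>H\<close>. The choice \<open>W = G * T\<close> puts \<open>B\<close> in the
    same position relative to \<open>A\<close>.\<close>
  define T where "T = mat_adjoint U * V"
  have T: "T \<in> unitaries n" unfolding T_def using U V by (intro mult_unitaries mat_adjoint_unitaries)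
  define W where "W = G * T"
  have W: "W \<in> unitaries n" unfolding W_def using G T by (intro mult_unitaries)
  define B where "B = conj_by W (diagonal n (\<lambda>i. \<phi> (ys ! i)))"
  note uD = unitariesD[OF U(1)] unitariesD[OF V(1)] unitariesD[OF G(1)] unitariesD[OF T] unitariesD[OF W]
  have sandwich: "diagonal n f - conj_by T (diagonal n g) = (diagonal n f * T - T * diagonal n g) * mat_adjoint T" for f g
    using uD by (simp add: minus_mult_distrib_mat[of _ n n _ _ n] mult_carrier_mat[of _ n n] conj_by_def
      assoc_mult_mat[of _ n n _ n _ n] right_mult_one_mat[of _ n n])
  define Dx where "Dx = diagonal n (\<lambda>i. complex_of_real (xs ! i))"
  define Dy where "Dy = diagonal n (\<lambda>i. complex_of_real (ys ! i))"
  have D: "Dx \<in> carrier_mat n n" "Dy \<in> carrier_mat n n" by (simp_all add: Dx_def Dy_def)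
  have B: "B \<in> carrier_mat n n" using uD by (simp add: B_def)
  have "A - B = conj_by G (diagonal n (\<lambda>i. \<phi> (xs ! i)) - conj_by T (diagonal n (\<lambda>i. \<phi> (ys ! i))))"
    using uD by (simp add: G2 B_def W_def conj_by_minus[of _ n] conj_by_conj_by[of _ n])
  then have "vec_space.rank n (A - B) \<le> vec_space.rank n (diagonal n (\<lambda>i. \<phi> (xs ! i)) - conj_by T (diagonal n (\<lambda>i. \<phi> (ys ! i))))"
    using rank_conj_by_le[OF G(1)] uD by (metis conj_by_carrier diagonal_carrier minus_carrier_mat)
  also have "diagonal n (\<lambda>i. \<phi> (xs ! i)) - conj_by T (diagonal n (\<lambda>i. \<phi> (ys ! i)))
      = diagonal n (\<lambda>i. \<alpha> (xs ! i)) * (Dx * T - T * Dy) * (diagonal n (\<lambda>i. \<beta> (ys ! i)) * mat_adjoint T)"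
  proof -
    have c: "Dx * T - T * Dy \<in> carrier_mat n n" using uD D by (simp add: mult_carrier_mat[of _ n n] minus_carrier_mat)
    \<comment> \<open>In entry \<open>(i,j)\<close> the left side is
      \<open>\<phi> (xs ! i) - \<phi> (ys ! j)\<close> times that of \<open>T\<close>. By
      \<open>diff\<close> this is the corresponding entry for the real eigenvalues, with row
      \<open>i\<close> scaled by \<open>\<alpha>\<close> and column \<open>j\<close> by
      \<open>\<beta>\<close>.\<close>
    have "diagonal n (\<lambda>i. \<phi> (xs ! i)) * T - T * diagonal n (\<lambda>i. \<phi> (ys ! i))
        = diagonal n (\<lambda>i. \<alpha> (xs ! i)) * (Dx * T - T * Dy) * diagonal n (\<lambda>i. \<beta> (ys ! i))"
      (is "?L = ?R")
    proof (rule eq_matI)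
      have R: "?R \<in> carrier_mat n n" and L: "?L \<in> carrier_mat n n"
        using c uD by (simp_all add: mult_carrier_mat[of _ n n] minus_carrier_mat)
      show "dim_row ?L = dim_row ?R" "dim_col ?L = dim_col ?R" using L R by auto
      fix i j assume "i < dim_row ?R" "j < dim_col ?R"
      then have ij: "i < n" "j < n" using R by auto
      have "?L $$ (i,j) = (\<phi> (xs ! i) - \<phi> (ys ! j)) * T $$ (i,j)"
        using ij uD by (simp add: diagonal_mult_index[of _ n n] mult_diagonal_index[of _ n n] algebra_simps del: index_mult_mat(1))
      also have "\<dots> = ?R $$ (i,j)"
        using ij uD c by (simp add: diff diagonal_mult_index[of _ n n] mult_diagonal_index[of _ n n]
          mult_carrier_mat[of _ n n] Dx_def Dy_def algebra_simps del: index_mult_mat(1))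
      finally show "?L $$ (i,j) = ?R $$ (i,j)" .
    qed
    then show ?thesis using c uD unfolding sandwich
      by (simp add: assoc_mult_mat[of _ n n _ n _ n] mult_carrier_mat[of _ n n])
  qed
  also have "vec_space.rank n \<dots> \<le> vec_space.rank n (Dx * T - T * Dy)"
    using uD D by (intro rank_mult_le) (simp_all add: mult_carrier_mat[of _ n n] minus_carrier_mat)
  \<comment> \<open>This returns from eigenvalues to matrices: it is \<open>H - K\<close> expressed
    in the eigenbases of \<open>K\<close> and \<open>H\<close>.\<close>
  also have "Dx * T - T * Dy = mat_adjoint U * (H - K) * V"
  proof -
    have UK: "mat_adjoint U * conj_by U M = M * mat_adjoint U" if "M \<in> carrier_mat n n" for M
    proof -
      have "mat_adjoint U * conj_by U M = mat_adjoint U * U * (M * mat_adjoint U)"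
        unfolding conj_by_def using uD(1,2) that by (simp only: assoc_mult_mat[of _ n n _ n _ n] mult_carrier_mat[of _ n n])
      then show ?thesis using uD that by (simp add: mult_carrier_mat[of _ n n] left_mult_one_mat[of _ n n])
    qed
    have VK: "conj_by V M * V = V * M" if "M \<in> carrier_mat n n" for M
    proof -
      have "conj_by V M * V = V * M * (mat_adjoint V * V)"
        unfolding conj_by_def using uD(5,6) that by (simp only: assoc_mult_mat[of _ n n _ n _ n] mult_carrier_mat[of _ n n])
      then show ?thesis using uD that by (simp add: mult_carrier_mat[of _ n n] right_mult_one_mat[of _ n n])
    qed
    have "mat_adjoint U * (H - K) * V = mat_adjoint U * H * V - mat_adjoint U * K * V"
      using uD H K by (simp add: mult_minus_distrib_mat[of _ n n _ n] minus_mult_distrib_mat[of _ n n _ _ n] mult_carrier_mat[of _ n n])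
    moreover have "mat_adjoint U * H * V = Dx * T"
      unfolding U2 Dx_def[symmetric] UK[OF D(1)] T_def using uD D by (intro assoc_mult_mat)
    moreover have "mat_adjoint U * K * V = T * Dy"
    proof -
      have "mat_adjoint U * K * V = mat_adjoint U * (K * V)" using uD K by (intro assoc_mult_mat)
      also have "\<dots> = mat_adjoint U * V * Dy"
        unfolding V2 Dy_def[symmetric] VK[OF D(2)] using uD D by (intro assoc_mult_mat[symmetric])
      finally show ?thesis by (simp add: T_def)
    qed
    ultimately show ?thesis by simp
  qed
  also have "vec_space.rank n \<dots> \<le> vec_space.rank n (H - K)"
    using uD H K by (intro rank_mult_le) (simp_all add: minus_carrier_mat)
  also note HK
  finally have "vec_space.rank n (A - B) \<le> ?d" .
  moreover have "sp B = image_mset \<phi> Y"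
  proof -
    have "B = conj_by W (diagonal n (\<lambda>i. map \<phi> ys ! i))"
      unfolding B_def using len by (intro arg_cong[of _ _ "conj_by W"] diagonal_cong) simp
    then show ?thesis using sp_conj_by_diagonal[OF W, of "map \<phi> ys"] len ys by simp
  qed
  moreover have "normal_mat B"
    unfolding B_def by (rule normal_conj_by[OF W])
      (simp_all add: normal_mat_def mat_adjoint_diagonal diagonal_mult mult.commute)
  \<comment> \<open>The reverse inequality is the lower bound, which is why \<open>B\<close> had to
    be shown normal.\<close>
  ultimately have "vec_space.rank n (A - B) = dc (sp A) (image_mset \<phi> Y)"
    using dc_le_rank[OF A(1,2) B] A(3) by simp
  then show thesis using that W len ys unfolding B_def by blast
qed

subsection \<open>The Cayley transform\<close>

lemma sp_self_adjoint_real: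
  assumes "A \<in> carrier_mat n n" "self_adjoint_mat A" "z \<in># sp A"
  shows "z \<in> \<real>"
proof -
  have adj: "mat_adjoint A = A" using assms(2) by (simp add: self_adjoint_mat_def)
  obtain es where es: "mset es = sp A" by (meson ex_mset)
  have len: "length es = n" using size_sp[OF assms(1)] es by (metis size_mset)
  obtain U where U: "U \<in> unitaries n" "A = conj_by U (diagonal n (\<lambda>i. es ! i))"
    using normal_diagonalization[OF assms(1) self_adjoint_normal[OF adj]] es by metis
  note [simp] = unitariesD[OF U(1)]
  have "conj_by U (diagonal n (\<lambda>i. cnj (es ! i))) = conj_by U (diagonal n (\<lambda>i. es ! i))"
    using adj U(2) by (simp add: mat_adjoint_conj_by[of _ n] mat_adjoint_diagonal)
  then have eq: "diagonal n (\<lambda>i. cnj (es ! i)) = diagonal n (\<lambda>i. es ! i)"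
    using conj_by_inverse(1)[OF U(1)] by (metis diagonal_carrier)
  have "cnj (es ! i) = es ! i" if "i < n" for i
    using arg_cong[OF eq, of "\<lambda>M. M $$ (i,i)"] that by simp
  moreover obtain i where "i < n" "z = es ! i"
    using assms(3) es len by (metis in_set_conv_nth set_mset_mset)
  ultimately show ?thesis by (simp add: Reals_cnj_iff)
qed

lemma sp_unitary_norm:
  assumes "A \<in> carrier_mat n n" "unitary_mat A" "z \<in># sp A"
  shows "cmod z = 1"
proof -
  have A: "A \<in> unitaries n" using assms(1,2) by (simp add: unitaries_def)
  have "normal_mat A" using unitariesD[OF A] by (simp add: normal_mat_def)
  obtain es where es: "mset es = sp A" by (meson ex_mset)
  have len: "length es = n" using size_sp[OF assms(1)] es by (metis size_mset)
  obtain U where U: "U \<in> unitaries n" "A = conj_by U (diagonal n (\<lambda>i. es ! i))"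
    using normal_diagonalization[OF assms(1) \<open>normal_mat A\<close>] es by metis
  note [simp] = unitariesD[OF U(1)]
  have "conj_by U (diagonal n (\<lambda>i. cnj (es ! i) * es ! i)) = mat_adjoint A * A"
    using U by (simp add: mat_adjoint_conj_by[of _ n] mat_adjoint_diagonal conj_by_mult[of _ n] diagonal_mult)
  also have "\<dots> = conj_by U (1\<^sub>m n)"
    using unitariesD[OF A] by (simp add: conj_by_def right_mult_one_mat[of _ n n])
  finally have eq: "diagonal n (\<lambda>i. cnj (es ! i) * es ! i) = 1\<^sub>m n"
    using conj_by_inverse(1)[OF U(1)] by (metis diagonal_carrier one_carrier_mat)
  obtain i where i: "i < n" "z = es ! i"
    using assms(3) es len by (metis in_set_conv_nth set_mset_mset)
  have "cnj z * z = 1"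
    using arg_cong[OF eq, of "\<lambda>M. M $$ (i,i)"] i by simp
  then have "(cmod z)\<^sup>2 = 1" by (metis complex_norm_square mult.commute of_real_eq_1_iff)
  then show ?thesis by (simp add: power2_eq_1_iff) (use norm_ge_zero[of z] in linarith)
qed

text \<open>The line is mapped onto the unit circle without \<open>\<omega>\<close>, the image of
  infinity. The rotation by \<open>\<omega>\<close> allows the omitted point to be placed away from
  prescribed eigenvalues.\<close>

definition cayley :: "complex \<Rightarrow> real \<Rightarrow> complex" where
  "cayley \<omega> x = \<omega> * ((of_real x - \<i>) / (of_real x + \<i>))"

lemma of_real_plus_i_nonzero: "complex_of_real x + \<i> \<noteq> 0"
  by (simp add: complex_eq_iff)

text \<open>Up to \<open>\<omega>\<close> the transform is \<open>1 - 2 * \<i> / (x + \<i>)\<close>,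
  and a difference of two reciprocals factors. The result has the shape required by
  \<open>normal_perturbation\<close>.\<close>

lemma cayley_diff:
  "cayley \<omega> x - cayley \<omega> y = (2 * \<i> * \<omega> / (of_real x + \<i>)) * of_real (x - y) * (1 / (of_real y + \<i>))"
proof -
  have *: "\<omega> * ((a - c) / a) - \<omega> * ((b - c) / b) = (c * \<omega> / a) * (a - b) * (1 / b)"
    if "a \<noteq> 0" "b \<noteq> 0" for a b c
    using that by (simp add: divide_simps) (simp add: algebra_simps)
  show ?thesis
    using *[OF of_real_plus_i_nonzero[of x] of_real_plus_i_nonzero[of y], of "2 * \<i>"]
    by (simp add: cayley_def)
qed

lemma cayley_one_Re_Im:
  "Re (cayley 1 x) = (x\<^sup>2 - 1) / (x\<^sup>2 + 1)" "Im (cayley 1 x) = - 2 * x / (x\<^sup>2 + 1)"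
  by (simp_all add: cayley_def Re_divide Im_divide power2_eq_square)

lemma norm_cayley:
  assumes "cmod \<omega> = 1"
  shows "cmod (cayley \<omega> x) = 1"
proof -
  have "cmod (of_real x - \<i>) = cmod (of_real x + \<i>)" by (simp add: cmod_def)
  then show ?thesis using assms of_real_plus_i_nonzero[of x] by (simp add: cayley_def norm_mult norm_divide)
qed

lemma cayley_surj:
  assumes "cmod \<omega> = 1" "cmod z = 1" "z \<noteq> \<omega>"
  shows "\<exists>x. cayley \<omega> x = z"
proof -
  define u where "u = z * cnj \<omega>"
  have w: "\<omega> * cnj \<omega> = 1" using assms(1) complex_norm_square[of \<omega>] by simp
  then have z: "z = \<omega> * u" by (simp add: u_def mult.left_commute)
  have "u \<noteq> 1" using z assms(3) by auto
  have "cmod u = 1" using assms by (simp add: u_def norm_mult)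
  then have n: "(Re u)\<^sup>2 + (Im u)\<^sup>2 = 1" by (simp add: cmod_def)
  have "Re u \<noteq> 1" using n \<open>u \<noteq> 1\<close> by (auto simp: complex_eq_iff)
  \<comment> \<open>Stereographic projection from 1: solving
    \<open>x - \<i> = u * (x + \<i>)\<close> gives \<open>\<i> * (1 + u) / (1 - u)\<close>, which is
    this real number when \<open>u\<close> has modulus one.\<close>
  define x where "x = - Im u / (1 - Re u)"
  have x1: "x * (1 - Re u) = - Im u" using \<open>Re u \<noteq> 1\<close> by (simp add: x_def)
  have "(x * Im u + (1 + Re u)) * (1 - Re u) = (x * (1 - Re u)) * Im u + (1 - (Re u)\<^sup>2)"
    by (simp add: algebra_simps power2_eq_square)
  also have "\<dots> = 0" using n unfolding x1 by (simp add: power2_eq_square)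
  finally have x2: "x * Im u = - (1 + Re u)" using \<open>Re u \<noteq> 1\<close> by simp
  have "of_real x - \<i> = u * (of_real x + \<i>)"
    using x1 x2 by (simp add: complex_eq_iff algebra_simps)
  then have "cayley \<omega> x = z" using of_real_plus_i_nonzero[of x] by (simp add: cayley_def z)
  then show ?thesis ..
qed

text \<open>On the unit circle a half plane cuts out the same arc as a disc of suitably large radius.\<close>

lemma cayley_disc:
  assumes \<omega>: "cmod \<omega> = 1" and "s < t"
  shows "\<exists>a r. r > 0 \<and> (\<forall>x. cayley \<omega> x \<in> closed_disc a r \<longleftrightarrow> s \<le> x \<and> x \<le> t)"
proof -
  \<comment> \<open>On the unit circle the disc with centre \<open>g\<close> and squared radius
    \<open>q\<close> is given by \<open>l\<close> times the half-plane form below being at most 0.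
    So every positive \<open>l\<close> cuts out the same arc; this one is small enough to make
    \<open>q\<close> positive.\<close>
  define l where "l = 1 / (1 + \<bar>1 + s * t\<bar>)"
  have l: "l > 0" "l * (1 + s * t) < 1" by (auto simp: l_def divide_simps)
  define g where "g = Complex (- (l / 2) * (1 - s * t)) (- (l / 2) * (s + t))"
  define q where "q = 1 + (cmod g)\<^sup>2 - l * (1 + s * t)"
  have q: "q > 0" using l(2) zero_le_power2[of "cmod g"] unfolding q_def by linarith
  have "cayley \<omega> x \<in> closed_disc (\<omega> * g) (sqrt q) \<longleftrightarrow> s \<le> x \<and> x \<le> t" for x
  proof -
    define u where "u = cayley 1 x"
    have "cmod u = 1" unfolding u_def by (rule norm_cayley) simp
    have "cayley \<omega> x - \<omega> * g = \<omega> * (u - g)" by (simp add: u_def cayley_def algebra_simps)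
    then have "cayley \<omega> x \<in> closed_disc (\<omega> * g) (sqrt q) \<longleftrightarrow> cmod (u - g) \<le> sqrt q"
      using \<omega> by (simp add: closed_disc_def norm_mult)
    also have "\<dots> \<longleftrightarrow> (cmod (u - g))\<^sup>2 \<le> q"
      using power_mono_iff[of "cmod (u - g)" "sqrt q" 2] q by simp
    also have "(cmod (u - g))\<^sup>2 = (cmod u)\<^sup>2 + (cmod g)\<^sup>2 + l * ((1 - s * t) * Re u + (s + t) * Im u)"
      unfolding cmod_power2 by (simp add: g_def power2_eq_square algebra_simps)
    also have "\<dots> \<le> q \<longleftrightarrow> l * ((1 + s * t) + (1 - s * t) * Re u + (s + t) * Im u) \<le> 0"
      using \<open>cmod u = 1\<close> by (simp add: q_def algebra_simps)
    also have "\<dots> \<longleftrightarrow> (1 + s * t) + (1 - s * t) * Re u + (s + t) * Im u \<le> 0"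
      using l(1) by (simp add: mult_le_0_iff)
    \<comment> \<open>The form vanishes on the chord through the images of \<open>s\<close> and
      \<open>t\<close>; pulled back to the line it has exactly these two zeros.\<close>
    also have "(1 + s * t) + (1 - s * t) * Re u + (s + t) * Im u = 2 * ((x - s) * (x - t)) / (x\<^sup>2 + 1)"
    proof -
      define N where "N = x\<^sup>2 + 1"
      have "N \<noteq> 0" unfolding N_def using add_nonneg_pos[of "x\<^sup>2" 1] by simp
      then have *: "a + b * (c / N) + d * (e / N) = (a * N + b * c + d * e) / N" for a b c d e
        by (simp add: field_simps)
      show ?thesis
        unfolding u_def cayley_one_Re_Im N_def[symmetric] *
        by (rule arg_cong[of _ _ "\<lambda>z. z / N"]) (simp add: N_def algebra_simps power2_eq_square)
    qed
    also have "\<dots> \<le> 0 \<longleftrightarrow> (x - s) * (x - t) \<le> 0"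
    proof -
      have "x\<^sup>2 + 1 > 0" by (rule add_nonneg_pos) simp_all
      then show ?thesis by (simp add: divide_le_0_iff)
    qed
    also have "\<dots> \<longleftrightarrow> s \<le> x \<and> x \<le> t"
      using \<open>s < t\<close> by (auto simp: mult_le_0_iff)
    finally show ?thesis .
  qed
  then show ?thesis using q by (intro exI[of _ "\<omega> * g"] exI[of _ "sqrt q"]) auto
qed

lemma of_real_disc:
  assumes "s < t"
  shows "\<exists>a r. r > 0 \<and> (\<forall>x. complex_of_real x \<in> closed_disc a r \<longleftrightarrow> s \<le> x \<and> x \<le> t)"
proof (intro exI conjI allI)
  show "(t - s) / 2 > 0" using assms by simp
  fix x
  have "cmod (of_real x - of_real ((s + t) / 2)) = \<bar>x - (s + t) / 2\<bar>"
    by (metis norm_of_real of_real_diff)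
  then have "complex_of_real x \<in> closed_disc (of_real ((s + t) / 2)) ((t - s) / 2) \<longleftrightarrow> \<bar>x - (s + t) / 2\<bar> \<le> (t - s) / 2"
    unfolding closed_disc_def mem_Collect_eq by (simp only:)
  also have "\<dots> \<longleftrightarrow> s \<le> x \<and> x \<le> t"
    unfolding abs_le_iff by (auto simp: field_simps)
  finally show "complex_of_real x \<in> closed_disc (of_real ((s + t) / 2)) ((t - s) / 2) \<longleftrightarrow> s \<le> x \<and> x \<le> t" .
qed

section \<open>Choosing the omitted point and assembling the two cases\<close>

lemma ex_unit_avoiding:
  assumes "finite F"
  obtains \<omega> where "cmod \<omega> = 1" "\<omega> \<notin> F"
proof -
  have "inj (cayley 1)"
  proof (rule injI)
    fix x y assume "cayley 1 x = cayley 1 y"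
    then show "x = y"
      using cayley_diff[of 1 x y] of_real_plus_i_nonzero[of x] of_real_plus_i_nonzero[of y] by simp
  qed
  then have "infinite (range (cayley 1))" using finite_imageD infinite_UNIV_char_0 by blast
  then have "\<not> range (cayley 1) \<subseteq> F" using finite_subset[OF _ assms] by auto
  then obtain x where "cayley 1 x \<notin> F" by auto
  then show thesis using that[of "cayley 1 x"] norm_cayley[of 1] by simp
qed

lemma image_mset_surj:
  assumes "\<And>z. z \<in># M \<Longrightarrow> \<exists>x. f x = z"
  obtains X where "M = image_mset f X"
proof -
  obtain g where "\<And>z. z \<in># M \<Longrightarrow> f (g z) = z" using assms by metis
  then have "M = image_mset f (image_mset g M)" by (simp add: image_mset.compositionality o_def cong: image_mset_cong)
  then show thesis by (rule that)
qed

theorem theorem4: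
  fixes n :: nat and A :: "complex mat" and \<B> :: "complex multiset"
  assumes "A \<in> carrier_mat n n" and "size \<B> = n"
  shows "(self_adjoint_mat A \<and> set_mset \<B> \<subseteq> \<real> \<longrightarrow>
           (\<exists>B \<in> carrier_mat n n. self_adjoint_mat B \<and> sp B = \<B> \<and>
              vec_space.rank n (A - B) = dc (sp A) \<B>)) \<and>
         (unitary_mat A \<and> set_mset \<B> \<subseteq> {z. cmod z = 1} \<longrightarrow>
           (\<exists>B \<in> carrier_mat n n. unitary_mat B \<and> sp B = \<B> \<and>
              vec_space.rank n (A - B) = dc (sp A) \<B>))"
proof (intro conjI impI; elim conjE)
  assume A: "self_adjoint_mat A" and \<B>: "set_mset \<B> \<subseteq> \<real>"
  obtain X where X: "sp A = image_mset complex_of_real X"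
    using image_mset_surj[of "sp A" complex_of_real] sp_self_adjoint_real[OF assms(1) A] by (metis Reals_cases)
  obtain Y where Y: "\<B> = image_mset complex_of_real Y"
    using image_mset_surj[of \<B> complex_of_real] \<B> by (metis Reals_cases subsetD)
  have sY: "size Y = n" using assms(2) Y by simp
  have N: "normal_mat A" using A by (simp add: self_adjoint_mat_def self_adjoint_normal)
  \<comment> \<open>For the inclusion of the reals the difference identity holds with both factors
    equal to 1.\<close>
  obtain W ys where W: "W \<in> unitaries n" "length ys = n" "mset ys = Y"
    "vec_space.rank n (A - conj_by W (diagonal n (\<lambda>i. of_real (ys ! i)))) = dc (sp A) \<B>"
    using normal_perturbation[OF assms(1) N X sY of_real_disc, of "\<lambda>_. 1" "\<lambda>_. 1"] Y by auto
  have eq: "diagonal n (\<lambda>i. map complex_of_real ys ! i) = diagonal n (\<lambda>i. of_real (ys ! i))"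
    using W(2) by (intro diagonal_cong) simp
  show "\<exists>B \<in> carrier_mat n n. self_adjoint_mat B \<and> sp B = \<B> \<and> vec_space.rank n (A - B) = dc (sp A) \<B>"
    using W unitariesD(1)[OF W(1)] conj_by_diagonal_self_adjoint[OF W(1), of "\<lambda>i. of_real (ys ! i)"]
      sp_conj_by_diagonal[OF W(1), of "map of_real ys"] Y eq
    by (intro bexI[of _ "conj_by W (diagonal n (\<lambda>i. of_real (ys ! i)))"]) auto
next
  assume A: "unitary_mat A" and \<B>: "set_mset \<B> \<subseteq> {z. cmod z = 1}"
  \<comment> \<open>The transform misses \<open>\<omega>\<close>, so \<open>\<omega>\<close> must
    avoid both the spectrum of \<open>A\<close> and the prescribed eigenvalues for these to have
    real preimages.\<close>
  obtain \<omega> where \<omega>: "cmod \<omega> = 1" "\<omega> \<notin> set_mset (sp A + \<B>)"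
    using ex_unit_avoiding[of "set_mset (sp A + \<B>)"] by auto
  have "\<exists>x. cayley \<omega> x = z" if "z \<in># sp A + \<B>" for z
    using that \<B> sp_unitary_norm[OF assms(1) A] \<omega> by (intro cayley_surj) auto
  then obtain X Y where X: "sp A = image_mset (cayley \<omega>) X" and Y: "\<B> = image_mset (cayley \<omega>) Y"
    using image_mset_surj[of "sp A" "cayley \<omega>"] image_mset_surj[of \<B> "cayley \<omega>"] by (metis union_iff)
  have sY: "size Y = n" using assms(2) Y by simp
  have N: "normal_mat A" using A by (simp add: unitary_mat_def normal_mat_def)
  obtain W ys where W: "W \<in> unitaries n" "length ys = n" "mset ys = Y"
    "vec_space.rank n (A - conj_by W (diagonal n (\<lambda>i. cayley \<omega> (ys ! i)))) = dc (sp A) \<B>"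
    using normal_perturbation[OF assms(1) N X sY cayley_disc[OF \<omega>(1)] cayley_diff] Y by auto
  have eq: "diagonal n (\<lambda>i. map (cayley \<omega>) ys ! i) = diagonal n (\<lambda>i. cayley \<omega> (ys ! i))"
    using W(2) by (intro diagonal_cong) simp
  show "\<exists>B \<in> carrier_mat n n. unitary_mat B \<and> sp B = \<B> \<and> vec_space.rank n (A - B) = dc (sp A) \<B>"
    using W unitariesD(1)[OF W(1)] conj_by_diagonal_unitary[OF W(1), of "\<lambda>i. cayley \<omega> (ys ! i)"]
      norm_cayley[OF \<omega>(1)] sp_conj_by_diagonal[OF W(1), of "map (cayley \<omega>) ys"] Y eq
    by (intro bexI[of _ "conj_by W (diagonal n (\<lambda>i. cayley \<omega> (ys ! i)))"]) auto
qed

end
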